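(* Let $X$ be a non-empty compact metric space, let $I_{\mathrm{ineq}}, I_{\mathrm{eq}}$ be disjoint finite sets with $0\notin I:=I_{\mathrm{ineq}}\cup I_{\mathrm{eq}}$, let $\Psi_i:\Xi(X)\to\mathbb{R}\cup\{\infty\}$ be lower semicontinuous for $i\in\{0\}\cup I_{\mathrm{ineq}}$ and let $\Psi_i:\Xi(X)\to\mathbb{R}$ be continuous for $i\in I_{\mathrm{eq}}$. Assume moreover: (1) $\Psi_0$ is convex and $\Psi_0|_{\operatorname{dom}\Psi_0}$ is directionally differentiable w.r.t. $\Xi(X)$ with a continuous sensitivity function $\psi_0:\operatorname{dom}\Psi_0\times X\to\mathbb{R}$; (2) for every $i\in I_{\mathrm{ineq}}$, $\Psi_i$ is convex and $\Psi_i|_{\operatorname{dom}\Psi_i}$ is directionally differentiable w.r.t. $\Xi(X)$ with a sensitivity function $\psi_i:\operatorname{dom}\Psi_i\times X\to\mathbb{R}$ that is either continuous, or of the form $\psi_i(\xi,x)=g_i(x)-\Psi_i(\xi)$ for all $(\xi,x)\in\operatorname{dom}\Psi_i\times X$ with some bounded measurable $g_i:X\to\mathbb{R}$; (3) $\Psi_i$ is affine for every $i\in I_{\mathrm{eq}}$. Let $\underline{\delta}_k\in(0,\infty)$ $(k\in\mathbb{N}_0)$ be tolerances with $\limsup_{k\to\infty}\underline{\delta}_k=0$, and let $X^0\neq\emptyset$ be a finite subset of $X$ such that (i) there exists $\eta^0\in\Xi_{\mathrm{fin}}(X^0)$ with $\Psi_i(\eta^0)<0$ for all $i\in I_{\mathrm{ineq}}$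 and $\Psi_i(\eta^0)=0$ for all $i\in I_{\mathrm{eq}}$, and (ii) the set $\{(\Psi_i(\xi))_{i\in I_{\mathrm{eq}}}:\xi\in\Xi(X^0)\}\subset\mathbb{R}^{I_{\mathrm{eq}}}$ is not one-sided w.r.t. $0$. Let $(\xi^k),(\lambda^k),(x^k)$ be generated by the special adaptive discretization algorithm (see context) with initial discretization $X^0$ and tolerances $\underline{\delta}_k$. Then: (i) If $(\xi^k)$ is terminating, then it terminates at an optimal solution of $\min_{\xi\in\Xi_{\mathrm{feas}}(X)}\Psi_0(\xi)$. (ii) If $(\xi^k)$ is not terminating, then it has an accumulation point and every accumulation point is an optimal solution of $\min_{\xi\in\Xi_{\mathrm{feas}}(X)}\Psi_0(\xi)$. Additionally, the values $\Psi_0(\xi^k)$ converge monotonically decreasingly to the optimal value: $$\Psi_0(\xi^k)\searrow\min_{\xi\in\Xi_{\mathrm{feas}}(X)}\Psi_0(\xi)\qquad(k\to\infty).$$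
   Context: $\Xi(X)$ is the set of Borel probability measures on $X$ with the weak topology (convergence in distribution); (semi)continuity and accumulation points refer to this topology. For closed $\emptyset\ne X^*\subset X$, $\Xi(X^* )$ is regarded as a subset of $\Xi(X)$ (extension by zero). $\operatorname{dom}\Psi:=\{\xi\in\Xi(X):\Psi(\xi)<\infty\}$. $\Psi|_{\operatorname{dom}\Psi}$ is directionally differentiable w.r.t. $\Xi(X)$ iff there is a (necessarily unique) function $\psi:\operatorname{dom}\Psi\times X\to\mathbb{R}$, called its sensitivity function, such that for every $\xi\in\operatorname{dom}\Psi$ and $\eta\in\Xi(X)$ the function $\psi(\xi,\cdot)$ is $\eta$-integrable and $\frac{\Psi(\xi+\alpha(\eta-\xi))-\Psi(\xi)}{\alpha}\to\int_X\psi(\xi,x)\,\mathrm{d}\eta(x)$ as $\alpha\searrow0$. For $i\in I_{\mathrm{eq}}$ the sensitivity function of the affine continuous $\Psi_i$ is $\psi_i(\xi,x)=\Psi_i(\delta_x)-\Psi_i(\xi)$. For closed $\emptyset\neq X^*\subset X$: $\Xi_{\mathrm{feas}}(X^* ):=\{\xi\in\Xi(X^* ):\Psi_i(\xi)\le0\ (i\in I_{\mathrm{ineq}}),\ \Psi_i(\xi)=0\ (i\in I_{\mathrm{eq}})\}$ and $\Xi_{\mathrm{fin}}(X^* ):=\Xi(X^* )\cap\operatorname{dom}\Psi_0\cap\bigcap_{i\in I}\operatorname{dom}\Psi_i$. Further $\Lambda:=[0,\infty)^{I_{\mathrm{ineq}}}\times\mathbb{R}^{I_{\mathrm{eq}}}$,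 $L(\xi,\lambda):=\Psi_0(\xi)+\sum_{i\in I}\lambda_i\Psi_i(\xi)$ and $\psi^L(\xi,\lambda,x):=\psi_0(\xi,x)+\sum_{i\in I}\lambda_i\psi_i(\xi,x)$ for $\xi\in\Xi_{\mathrm{fin}}(X)$, $\lambda\in\Lambda$, $x\in X$. A saddle point of the problem $\min_{\xi\in\Xi_{\mathrm{feas}}(X^* )}\Psi_0(\xi)$ is a pair $(\xi^*,\lambda^* )\in\Xi_{\mathrm{fin}}(X^* )\times\Lambda$ with $L(\xi^*,\lambda)\le L(\xi^*,\lambda^* )\le L(\xi,\lambda^* )$ for all $\xi\in\Xi_{\mathrm{fin}}(X^* )$, $\lambda\in\Lambda$. An optimal solution of $\min_{\xi\in\Xi_{\mathrm{feas}}(X)}\Psi_0(\xi)$ is a $\xi^*\in\Xi_{\mathrm{feas}}(X)$ with $\Psi_0(\xi^* )\le\inf_{\xi\in\Xi_{\mathrm{feas}}(X)}\Psi_0(\xi)$. A subset $Z\subset\mathbb{R}^J$ ($J$ finite) is one-sided w.r.t. $0$ iff there is $\nu\in\mathbb{R}^J\setminus\{0\}$ with $\nu^\top z\ge0$ for all $z\in Z$ (so if $J=\emptyset$, no set is one-sided). Special adaptive discretization algorithm. Input: non-empty finite $X^0\subset X$, tolerances $\underline{\delta}_k>0$. Start with $k=0$. Step 1: compute a saddle point $(\xi^k,\lambda^k)$ of $\min_{\xi\in\Xi_{\mathrm{feas}}(X^k)}\Psi_0(\xi)$. Step 2: compute $x^k\in X$ with $\psi^L(\xi^k,\lambda^k,x^k)\le\inf_{x\in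 X}\psi^L(\xi^k,\lambda^k,x)+\underline{\delta}_k$. If $\psi^L(\xi^k,\lambda^k,x^k)-\underline{\delta}_k<0$, set $X^{k+1}:=X^k\cup\{x^k\}$ and return to Step 1 with $k+1$ in place of $k$; otherwise terminate (at $\xi^k$). The choices of saddle points and of the $x^k$ are arbitrary. $(\xi^k)$ is called terminating iff the algorithm terminates after finitely many iterations. *)

theory Defs
  imports "HOL-Probability.Probability"
begin

subsection \<open>Borel probability measures and the weak topology\<close>

text \<open>The compact metric space is the whole type. A Borel probability measure on a subset \<open>A\<close>
  becomes one on the whole space by extension by zero, that is, by pushing it forward along the
  inclusion; lemma \<open>Xi_eq\<close> describes the result for Borel sets \<open>A\<close>.\<close>

definition Xi :: "'a::topological_space set \<Rightarrow> 'a measure set"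
  where "Xi A = (\<lambda>\<mu>. distr \<mu> borel (\<lambda>x. x)) ` space (prob_algebra (restrict_space borel A))"

definition weak_topology :: "'a::topological_space measure topology"
  where "weak_topology = topology_generated_by
    {{\<xi> \<in> Xi UNIV. (\<integral>x. f x \<partial>\<xi>) \<in> U} | (f :: 'a \<Rightarrow> real) U.
       continuous_on UNIV f \<and> bounded (range f) \<and> open U}"

text \<open>The measure $\xi + \alpha(\eta - \xi)$ for $\alpha \in [0,1]$.\<close>

definition mix :: "real \<Rightarrow> 'a measure \<Rightarrow> 'a measure \<Rightarrow> 'a measure"
  where "mix \<alpha> \<xi> \<eta> = measure_of (space \<xi>) (sets \<xi>)
    (\<lambda>A. ennreal (1 - \<alpha>) * emeasure \<xi> A + ennreal \<alpha> * emeasure \<eta> A)"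

definition accumulation_point :: "'b topology \<Rightarrow> (nat \<Rightarrow> 'b) \<Rightarrow> 'b \<Rightarrow> bool"
  where "accumulation_point T s a \<longleftrightarrow>
    a \<in> topspace T \<and> (\<forall>U. openin T U \<and> a \<in> U \<longrightarrow> (\<exists>\<^sub>\<infinity>k. s k \<in> U))"

definition lower_semicontinuous_map :: "'b topology \<Rightarrow> ('b \<Rightarrow> ereal) \<Rightarrow> bool"
  where "lower_semicontinuous_map T f \<longleftrightarrow> (\<forall>c. openin T {x \<in> topspace T. c < f x})"


subsection \<open>Functionals on probability measures\<close>

definition fin_dom :: "('a::topological_space measure \<Rightarrow> ereal) \<Rightarrow> 'a measure set"
  where "fin_dom \<Psi> = {\<xi> \<in> Xi UNIV. \<Psi> \<xi> < \<infinity>}"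

definition convex_functional :: "('a::topological_space measure \<Rightarrow> ereal) \<Rightarrow> bool"
  where "convex_functional \<Psi> \<longleftrightarrow> (\<forall>\<xi>\<in>Xi UNIV. \<forall>\<eta>\<in>Xi UNIV. \<forall>\<alpha>\<in>{0..1}.
    \<Psi> (mix \<alpha> \<xi> \<eta>) \<le> ereal (1 - \<alpha>) * \<Psi> \<xi> + ereal \<alpha> * \<Psi> \<eta>)"

definition affine_functional :: "('a::topological_space measure \<Rightarrow> ereal) \<Rightarrow> bool"
  where "affine_functional \<Psi> \<longleftrightarrow> (\<forall>\<xi>\<in>Xi UNIV. \<forall>\<eta>\<in>Xi UNIV. \<forall>\<alpha>\<in>{0..1}.
    \<Psi> (mix \<alpha> \<xi> \<eta>) = ereal (1 - \<alpha>) * \<Psi> \<xi> + ereal \<alpha> * \<Psi> \<eta>)"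

text \<open>Directional differentiability of \<open>\<Psi>\<close> on its domain with sensitivity function \<open>\<psi>\<close>; only the
  values \<open>\<psi> \<xi> x\<close> with \<open>\<xi> \<in> fin_dom \<Psi>\<close> are relevant.\<close>

definition has_sensitivity ::
  "('a::topological_space measure \<Rightarrow> ereal) \<Rightarrow> ('a measure \<Rightarrow> 'a \<Rightarrow> real) \<Rightarrow> bool"
  where "has_sensitivity \<Psi> \<psi> \<longleftrightarrow> (\<forall>\<xi>\<in>fin_dom \<Psi>. \<forall>\<eta>\<in>Xi UNIV.
    integrable \<eta> (\<psi> \<xi>) \<and>
    ((\<lambda>\<alpha>. (\<Psi> (mix \<alpha> \<xi> \<eta>) - \<Psi> \<xi>) / ereal \<alpha>) \<longlongrightarrow> ereal (\<integral>x. \<psi> \<xi> x \<partial>\<eta>)) (at_right 0))"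

definition continuous_sensitivity ::
  "('a::topological_space measure \<Rightarrow> ereal) \<Rightarrow> ('a measure \<Rightarrow> 'a \<Rightarrow> real) \<Rightarrow> bool"
  where "continuous_sensitivity \<Psi> \<psi> \<longleftrightarrow>
    continuous_map (prod_topology (subtopology weak_topology (fin_dom \<Psi>)) euclidean) euclideanreal
      (\<lambda>(\<xi>, x). \<psi> \<xi> x)"


subsection \<open>The constrained problem and its saddle points\<close>

text \<open>The index type contains \<open>0\<close>, the index of the objective; \<open>Iineq\<close> and \<open>Ieq\<close> are the index sets
  of the inequality and the equality constraints.\<close>

definition Xi_feas :: "('i::zero \<Rightarrow> 'a::topological_space measure \<Rightarrow> ereal) \<Rightarrow>
    'i set \<Rightarrow> 'i set \<Rightarrow> 'a set \<Rightarrow> 'a measure set"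
  where "Xi_feas \<Psi> Iineq Ieq A =
    {\<xi> \<in> Xi A. (\<forall>i\<in>Iineq. \<Psi> i \<xi> \<le> 0) \<and> (\<forall>i\<in>Ieq. \<Psi> i \<xi> = 0)}"

definition Xi_fin :: "('i::zero \<Rightarrow> 'a::topological_space measure \<Rightarrow> ereal) \<Rightarrow>
    'i set \<Rightarrow> 'i set \<Rightarrow> 'a set \<Rightarrow> 'a measure set"
  where "Xi_fin \<Psi> Iineq Ieq A = Xi A \<inter> fin_dom (\<Psi> 0) \<inter> (\<Inter>i\<in>Iineq \<union> Ieq. fin_dom (\<Psi> i))"

definition multipliers :: "'i set \<Rightarrow> 'i set \<Rightarrow> ('i \<Rightarrow> real) set"
  where "multipliers Iineq Ieq = (\<Pi>\<^sub>E i\<in>Iineq \<union> Ieq. if i \<in> Iineq then {0..} else UNIV)"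

definition Lagrangian :: "('i::zero \<Rightarrow> 'a measure \<Rightarrow> ereal) \<Rightarrow>
    'i set \<Rightarrow> 'i set \<Rightarrow> 'a measure \<Rightarrow> ('i \<Rightarrow> real) \<Rightarrow> ereal"
  where "Lagrangian \<Psi> Iineq Ieq \<xi> l = \<Psi> 0 \<xi> + (\<Sum>i\<in>Iineq \<union> Ieq. ereal (l i) * \<Psi> i \<xi>)"

definition Lagrangian_sensitivity :: "('i::zero \<Rightarrow> 'a measure \<Rightarrow> 'a \<Rightarrow> real) \<Rightarrow>
    'i set \<Rightarrow> 'i set \<Rightarrow> 'a measure \<Rightarrow> ('i \<Rightarrow> real) \<Rightarrow> 'a \<Rightarrow> real"
  where "Lagrangian_sensitivity \<psi> Iineq Ieq \<xi> l x =
    \<psi> 0 \<xi> x + (\<Sum>i\<in>Iineq \<union> Ieq. l i * \<psi> i \<xi> x)"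

definition saddle_point :: "('i::zero \<Rightarrow> 'a::topological_space measure \<Rightarrow> ereal) \<Rightarrow>
    'i set \<Rightarrow> 'i set \<Rightarrow> 'a set \<Rightarrow> 'a measure \<Rightarrow> ('i \<Rightarrow> real) \<Rightarrow> bool"
  where "saddle_point \<Psi> Iineq Ieq A \<xi>s ls \<longleftrightarrow>
    \<xi>s \<in> Xi_fin \<Psi> Iineq Ieq A \<and> ls \<in> multipliers Iineq Ieq \<and>
    (\<forall>\<xi>\<in>Xi_fin \<Psi> Iineq Ieq A. \<forall>l\<in>multipliers Iineq Ieq.
       Lagrangian \<Psi> Iineq Ieq \<xi>s l \<le> Lagrangian \<Psi> Iineq Ieq \<xi>s ls \<and>
       Lagrangian \<Psi> Iineq Ieq \<xi>s ls \<le> Lagrangian \<Psi> Iineq Ieq \<xi> ls)"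

definition optimal_solution :: "('i::zero \<Rightarrow> 'a::topological_space measure \<Rightarrow> ereal) \<Rightarrow>
    'i set \<Rightarrow> 'i set \<Rightarrow> 'a measure \<Rightarrow> bool"
  where "optimal_solution \<Psi> Iineq Ieq \<xi>s \<longleftrightarrow>
    \<xi>s \<in> Xi_feas \<Psi> Iineq Ieq UNIV \<and> \<Psi> 0 \<xi>s \<le> (INF \<xi>\<in>Xi_feas \<Psi> Iineq Ieq UNIV. \<Psi> 0 \<xi>)"

definition one_sided :: "'j set \<Rightarrow> ('j \<Rightarrow> real) set \<Rightarrow> bool"
  where "one_sided J Z \<longleftrightarrow> (\<exists>\<nu>. (\<exists>j\<in>J. \<nu> j \<noteq> 0) \<and> (\<forall>z\<in>Z. 0 \<le> (\<Sum>j\<in>J. \<nu> j * z j)))"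


subsection \<open>The adaptive discretization algorithm\<close>

text \<open>A run is recorded by sequences \<open>Xs\<close> (discretizations), \<open>\<xi>\<close>, \<open>l\<close>, \<open>x\<close>. Iteration \<open>k\<close> is
  carried out iff \<open>proceeds\<close> holds at all earlier iterations. If the run terminates, the entries
  after the final iteration are unconstrained.\<close>

definition proceeds :: "('i::zero \<Rightarrow> 'a measure \<Rightarrow> 'a \<Rightarrow> real) \<Rightarrow> 'i set \<Rightarrow> 'i set \<Rightarrow> (nat \<Rightarrow> real) \<Rightarrow>
    (nat \<Rightarrow> 'a measure) \<Rightarrow> (nat \<Rightarrow> 'i \<Rightarrow> real) \<Rightarrow> (nat \<Rightarrow> 'a) \<Rightarrow> nat \<Rightarrow> bool"
  where "proceeds \<psi> Iineq Ieq \<delta> \<xi> l x k \<longleftrightarrow>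
    Lagrangian_sensitivity \<psi> Iineq Ieq (\<xi> k) (l k) (x k) - \<delta> k < 0"

definition generated :: "('i::zero \<Rightarrow> 'a::topological_space measure \<Rightarrow> ereal) \<Rightarrow>
    ('i \<Rightarrow> 'a measure \<Rightarrow> 'a \<Rightarrow> real) \<Rightarrow> 'i set \<Rightarrow> 'i set \<Rightarrow> 'a set \<Rightarrow> (nat \<Rightarrow> real) \<Rightarrow>
    (nat \<Rightarrow> 'a set) \<Rightarrow> (nat \<Rightarrow> 'a measure) \<Rightarrow> (nat \<Rightarrow> 'i \<Rightarrow> real) \<Rightarrow> (nat \<Rightarrow> 'a) \<Rightarrow> bool"
  where "generated \<Psi> \<psi> Iineq Ieq X0 \<delta> Xs \<xi> l x \<longleftrightarrow>
    Xs 0 = X0 \<and>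
    (\<forall>k. (\<forall>j<k. proceeds \<psi> Iineq Ieq \<delta> \<xi> l x j) \<longrightarrow>
       saddle_point \<Psi> Iineq Ieq (Xs k) (\<xi> k) (l k) \<and>
       ereal (Lagrangian_sensitivity \<psi> Iineq Ieq (\<xi> k) (l k) (x k))
         \<le> (INF y. ereal (Lagrangian_sensitivity \<psi> Iineq Ieq (\<xi> k) (l k) y)) + ereal (\<delta> k) \<and>
       (proceeds \<psi> Iineq Ieq \<delta> \<xi> l x k \<longrightarrow> Xs (Suc k) = Xs k \<union> {x k}))"

definition terminates_at :: "('i::zero \<Rightarrow> 'a measure \<Rightarrow> 'a \<Rightarrow> real) \<Rightarrow> 'i set \<Rightarrow> 'i set \<Rightarrow>
    (nat \<Rightarrow> real) \<Rightarrow> (nat \<Rightarrow> 'a measure) \<Rightarrow> (nat \<Rightarrow> 'i \<Rightarrow> real) \<Rightarrow> (nat \<Rightarrow> 'a) \<Rightarrow> nat \<Rightarrow> bool"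
  where "terminates_at \<psi> Iineq Ieq \<delta> \<xi> l x K \<longleftrightarrow>
    (\<forall>j<K. proceeds \<psi> Iineq Ieq \<delta> \<xi> l x j) \<and> \<not> proceeds \<psi> Iineq Ieq \<delta> \<xi> l x K"


subsection \<open>Basic facts about the definitions\<close>

lemma Xi_UNIV: "Xi UNIV = {\<xi> :: 'a::topological_space measure. sets \<xi> = sets borel \<and> prob_space \<xi>}"
proof -
  have 1: "sets (restrict_space borel (UNIV :: 'a set)) = sets borel"
    by (simp add: sets_restrict_space)
  have 2: "space (prob_algebra (restrict_space borel (UNIV :: 'a set)))
      = {\<xi>. sets \<xi> = sets borel \<and> prob_space \<xi>}"
    using 1 by (auto simp: prob_algebra_def space_restrict_space space_subprob_algebra
        prob_space_imp_subprob_space)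
  have 3: "distr \<xi> borel (\<lambda>x. x) = \<xi>" if "sets \<xi> = sets borel" for \<xi> :: "'a measure"
    using that by (intro distr_id2) simp
  show ?thesis
    unfolding Xi_def 2 using 3 by (auto simp: image_iff)
qed

lemma Xi_eq:
  fixes A :: "'a::topological_space set"
  assumes A: "A \<in> sets borel"
  shows "Xi A = {\<xi>. sets \<xi> = sets borel \<and> prob_space \<xi> \<and> emeasure \<xi> A = 1}"
proof (intro equalityI subsetI)
  fix \<xi> assume "\<xi> \<in> Xi A"
  then obtain \<mu> where \<mu>: "sets \<mu> = sets (restrict_space borel A)" "prob_space \<mu>"
    and \<xi>: "\<xi> = distr \<mu> borel (\<lambda>x. x)"
    by (auto simp: Xi_def prob_algebra_def space_restrict_space space_subprob_algebra)
  have sp: "space \<mu> = A"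
    using sets_eq_imp_space_eq[OF \<mu>(1)] by (simp add: space_restrict_space)
  have m: "(\<lambda>x. x) \<in> measurable \<mu> borel"
    using measurable_restrict_space1[of "\<lambda>x. x" borel borel A] measurable_cong_sets[OF \<mu>(1) refl]
    by auto
  show "\<xi> \<in> {\<xi>. sets \<xi> = sets borel \<and> prob_space \<xi> \<and> emeasure \<xi> A = 1}"
    using prob_space.prob_space_distr[OF \<mu>(2) m] prob_space.emeasure_space_1[OF \<mu>(2)] A m sp
    by (simp add: \<xi> emeasure_distr)
next
  fix \<xi> assume "\<xi> \<in> {\<xi>. sets \<xi> = sets borel \<and> prob_space \<xi> \<and> emeasure \<xi> A = 1}"
  then have \<xi>: "sets \<xi> = sets borel" "prob_space \<xi>" "emeasure \<xi> A = 1" by auto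
  define \<mu> where "\<mu> = restrict_space \<xi> A"
  have A': "A \<in> sets \<xi>" "A \<inter> space \<xi> = A" using A \<xi>(1) sets.sets_into_space[of A \<xi>] by auto
  have sets: "sets \<mu> = sets (restrict_space borel A)"
    by (simp add: \<mu>_def sets_restrict_space \<xi>(1))
  have p: "prob_space \<mu>"
    using A' \<xi>(3) by (intro prob_spaceI) (simp add: \<mu>_def space_restrict_space emeasure_restrict_space)
  have m: "(\<lambda>x. x) \<in> measurable \<mu> borel"
    using measurable_restrict_space1[of "\<lambda>x. x" borel borel A] measurable_cong_sets[OF sets refl]
    by auto
  have spm: "space \<mu> = A" using A' by (simp add: \<mu>_def space_restrict_space)
  have "\<xi> = distr \<mu> borel (\<lambda>x. x)"
  proof (rule measure_eqI)
    show "sets \<xi> = sets (distr \<mu> borel (\<lambda>x. x))" using \<xi>(1) by simp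
    fix B assume B: "B \<in> sets \<xi>"
    have "AE x in \<xi>. x \<in> A"
      using prob_space.AE_prob_1[OF \<xi>(2), of A] \<xi>(3) by (simp add: measure_def)
    then have "emeasure \<xi> B = emeasure \<xi> (B \<inter> A)"
      using A' B by (intro emeasure_eq_AE) auto
    also have "\<dots> = emeasure (distr \<mu> borel (\<lambda>x. x)) B"
      using A' B \<xi>(1) m spm
      by (simp add: emeasure_distr) (simp add: \<mu>_def emeasure_restrict_space)
    finally show "emeasure \<xi> B = emeasure (distr \<mu> borel (\<lambda>x. x)) B" .
  qed
  then show "\<xi> \<in> Xi A"
    using sets p by (auto simp: Xi_def prob_algebra_def space_restrict_space space_subprob_algebra
        prob_space_imp_subprob_space)
qed

lemma topspace_weak_topology [simp]: "topspace weak_topology = Xi (UNIV :: 'a::topological_space set)"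
proof -
  have "Xi (UNIV :: 'a set) \<in> {{\<xi> \<in> Xi UNIV. (\<integral>x. f x \<partial>\<xi>) \<in> U} | (f :: 'a \<Rightarrow> real) U.
       continuous_on UNIV f \<and> bounded (range f) \<and> open U}"
    by (rule CollectI, rule exI[of _ "\<lambda>_. 0"], rule exI[of _ UNIV]) auto
  then show ?thesis
    unfolding weak_topology_def topology_generated_by_topspace by blast
qed

lemma limitin_weak_topology:
  fixes s :: "'b \<Rightarrow> 'a::topological_space measure"
  assumes s: "\<And>k. s k \<in> Xi UNIV"
  shows "limitin weak_topology s \<xi> F \<longleftrightarrow> \<xi> \<in> Xi UNIV \<and>
    (\<forall>f :: 'a \<Rightarrow> real. continuous_on UNIV f \<longrightarrow> bounded (range f) \<longrightarrow>
       ((\<lambda>k. \<integral>x. f x \<partial>s k) \<longlongrightarrow> (\<integral>x. f x \<partial>\<xi>)) F)" (is "_ \<longleftrightarrow> _ \<and> ?conv")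
proof
  assume lim: "limitin weak_topology s \<xi> F"
  have "((\<lambda>k. \<integral>x. f x \<partial>s k) \<longlongrightarrow> (\<integral>x. f x \<partial>\<xi>)) F"
    if f: "continuous_on UNIV f" "bounded (range f)" for f :: "'a \<Rightarrow> real"
  proof (rule topological_tendstoI)
    fix U :: "real set" assume U: "open U" "(\<integral>x. f x \<partial>\<xi>) \<in> U"
    have "openin weak_topology {\<xi> \<in> Xi UNIV. (\<integral>x. f x \<partial>\<xi>) \<in> U}"
      unfolding weak_topology_def by (rule topology_generated_by_Basis) (use f U in blast)
    then have "\<forall>\<^sub>F k in F. s k \<in> {\<xi> \<in> Xi UNIV. (\<integral>x. f x \<partial>\<xi>) \<in> U}"
      using lim U by (auto simp: limitin_def)
    then show "\<forall>\<^sub>F k in F. (\<integral>x. f x \<partial>s k) \<in> U" by eventually_elim auto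
  qed
  then show "\<xi> \<in> Xi UNIV \<and> ?conv" using lim by (auto simp: limitin_def)
next
  assume R: "\<xi> \<in> Xi UNIV \<and> ?conv"
  have "\<forall>\<^sub>F k in F. s k \<in> U" if "generate_topology_on
    {{\<xi> \<in> Xi UNIV. (\<integral>x. f x \<partial>\<xi>) \<in> U} | (f :: 'a \<Rightarrow> real) U.
       continuous_on UNIV f \<and> bounded (range f) \<and> open U} U" "\<xi> \<in> U" for U
    using that
  proof (induction rule: generate_topology_on.induct)
    case (Int a b)
    then show ?case by (auto intro: eventually_conj)
  next
    case (UN K)
    then obtain k where "k \<in> K" "\<xi> \<in> k" by blast
    with UN have "\<forall>\<^sub>F j in F. s j \<in> k" by blast
    then show ?case using \<open>k \<in> K\<close> by (auto elim: eventually_mono)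
  next
    case (Basis V)
    then obtain f :: "'a \<Rightarrow> real" and U where f: "continuous_on UNIV f" "bounded (range f)" "open U"
      and V: "V = {\<xi> \<in> Xi UNIV. (\<integral>x. f x \<partial>\<xi>) \<in> U}" by blast
    have "((\<lambda>k. \<integral>x. f x \<partial>s k) \<longlongrightarrow> (\<integral>x. f x \<partial>\<xi>)) F" using R f by blast
    then have "\<forall>\<^sub>F k in F. (\<integral>x. f x \<partial>s k) \<in> U"
      using Basis f(3) V by (auto dest: topological_tendstoD)
    then show ?case using s by (simp add: V)
  qed simp
  then have "\<forall>\<^sub>F k in F. s k \<in> U" if "openin weak_topology U" "\<xi> \<in> U" for U
    using that unfolding weak_topology_def openin_topology_generated_by_iff by blast
  then show "limitin weak_topology s \<xi> F"
    using R unfolding limitin_def topspace_weak_topology by blast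
qed

lemma sets_mix [simp]: "sets (mix \<alpha> \<xi> \<eta>) = sets \<xi>"
  by (simp add: mix_def)

lemma emeasure_mix:
  assumes "sets \<eta> = sets \<xi>" and A: "A \<in> sets \<xi>"
  shows "emeasure (mix \<alpha> \<xi> \<eta>) A = ennreal (1 - \<alpha>) * emeasure \<xi> A + ennreal \<alpha> * emeasure \<eta> A"
proof (rule emeasure_measure_of[OF mix_def])
  show "sets \<xi> \<subseteq> Pow (space \<xi>)" by (rule sets.space_closed)
  show "positive (sets (mix \<alpha> \<xi> \<eta>))
      (\<lambda>A. ennreal (1 - \<alpha>) * emeasure \<xi> A + ennreal \<alpha> * emeasure \<eta> A)"
    by (simp add: positive_def)
  show "countably_additive (sets (mix \<alpha> \<xi> \<eta>))
      (\<lambda>A. ennreal (1 - \<alpha>) * emeasure \<xi> A + ennreal \<alpha> * emeasure \<eta> A)"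
    using assms(1)
    by (auto simp: countably_additive_def suminf_emeasure suminf_add[symmetric] subset_eq)
  show "A \<in> sets (mix \<alpha> \<xi> \<eta>)" using A by simp
qed

lemma mix_in_Xi:
  assumes "\<xi> \<in> Xi UNIV" "\<eta> \<in> Xi UNIV" "0 \<le> \<alpha>" "\<alpha> \<le> 1"
  shows "mix \<alpha> \<xi> \<eta> \<in> Xi UNIV"
proof -
  have s: "sets \<eta> = sets \<xi>" "sets \<xi> = sets borel" "prob_space \<xi>" "prob_space \<eta>"
    using assms by (auto simp: Xi_UNIV)
  have sp: "space (mix \<alpha> \<xi> \<eta>) = space \<xi>" "space \<eta> = space \<xi>"
    by (rule sets_eq_imp_space_eq, simp add: s(1))+
  have "emeasure (mix \<alpha> \<xi> \<eta>) (space \<xi>) = ennreal (1 - \<alpha>) + ennreal \<alpha>"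
    using prob_space.emeasure_space_1[OF s(3)] prob_space.emeasure_space_1[OF s(4)] sp(2)
    by (simp add: emeasure_mix[OF s(1)])
  also have "\<dots> = 1" using assms(3,4) by (simp flip: ennreal_plus)
  finally have "prob_space (mix \<alpha> \<xi> \<eta>)" by (intro prob_spaceI) (simp add: sp)
  then show ?thesis using s by (simp add: Xi_UNIV)
qed

end

theory Submission
  imports Defs
begin

text \<open>Convexity turns a lower bound \<open>m\<close> for the sensitivity function of the Lagrangian at the saddle point
  \<open>(\<xi> k, l k)\<close> into the bound \<open>\<Psi> 0 (\<xi> k) + m\<close> for the optimal value; termination means \<open>m = 0\<close>.
  If the algorithm does not terminate, earlier points \<open>x j\<close> belong to the current discretization, so the
  sensitivity function is nonnegative there. The multipliers stay bounded by the Slater condition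
  and the lack of one-sidedness, and the points \<open>x k\<close> and measures \<open>\<xi> k\<close> cluster; hence the
  value at the new point \<open>x k\<close>, which is almost the infimum, is infinitely often larger than \<open>-e\<close>.
  As the values \<open>\<Psi> 0 (\<xi> k)\<close> decrease, one subsequence suffices for their convergence to the optimal value,
  and lower semicontinuity carries optimality over to all accumulation points.

  Weak sequential compactness of the probability measures is reduced to Helly's selection theorem on
  the real line by a Borel embedding of the space into a compact set of reals that has a continuous
  inverse.\<close>

subsection \<open>Weak sequential compactness\<close>

text \<open>Differentiability towards every measure has a hidden consequence: a difference quotient
  with an infinite numerator cannot approach a real limit, so a short initial segment from a point
  of finite values towards any measure stays in all domains. Hence Dirac measures, even of infinite
  cost, are legitimate directions for first-order conditions, and one-sidedness can be exploited
  with all of \<open>Xi X0\<close>. Lower semicontinuity alone does not make the constraint values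
  \<open>P i (\<xi> k)\<close> converge. The argument therefore controls only differences of
  sensitivities at two points, in an iterated limit: an earlier point is fixed first, then the later
  iterates move. A uniform multiplier bound is enough for this. Discretizations never lose points;
  this gives both the decreasing values and the nonnegativity at old points. The embedding into the
  reals has to be discontinuous in general (a sphere has no continuous injection into the line).
  Test functions are therefore transported through the continuous inverse.\<close>

definition ternary :: "(nat \<Rightarrow> bool) \<Rightarrow> real"
  where "ternary b = (\<Sum>j. (if b j then 2 else 0) / 3 ^ Suc j)"

lemma ternary_summable: "summable (\<lambda>j. (if b j then 2 else 0 :: real) / 3 ^ Suc j)"
proof (rule summable_comparison_test')
  show "summable (\<lambda>j. 2 / 3 * (1 / 3 :: real) ^ j)"
    by (intro summable_mult summable_geometric) auto
  show "norm ((if b j then 2 else 0 :: real) / 3 ^ Suc j) \<le> 2 / 3 * (1 / 3) ^ j" for j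
    by (auto simp: power_divide)
qed

lemma ternary_nonneg: "0 \<le> ternary b"
  unfolding ternary_def by (intro suminf_nonneg ternary_summable) auto

lemma ternary_le_1: "ternary b \<le> 1"
proof -
  have "ternary b \<le> (\<Sum>j. 2 / 3 * (1 / 3 :: real) ^ j)"
    unfolding ternary_def
    by (intro suminf_le ternary_summable summable_mult summable_geometric)
       (auto simp: power_divide)
  also have "\<dots> = 2 / 3 * (\<Sum>j. (1 / 3 :: real) ^ j)"
    by (intro suminf_mult summable_geometric) auto
  also have "\<dots> = 1" by (subst suminf_geometric) auto
  finally show ?thesis .
qed

lemma ternary_shift: "ternary b = (if b 0 then 2 else 0) / 3 + ternary (\<lambda>j. b (Suc j)) / 3"
proof -
  have "ternary b = (if b 0 then 2 else 0) / 3 + (\<Sum>j. (if b (Suc j) then 2 else 0) / 3 ^ Suc (Suc j))"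
    unfolding ternary_def using suminf_split_head[OF ternary_summable, of b] by simp
  also have "(\<Sum>j. (if b (Suc j) then 2 else 0 :: real) / 3 ^ Suc (Suc j)) =
      (\<Sum>j. (1 / 3) * ((if b (Suc j) then 2 else 0) / 3 ^ Suc j))"
    by (intro arg_cong[where f = suminf] ext) simp
  also have "\<dots> = ternary (\<lambda>j. b (Suc j)) / 3"
    unfolding ternary_def by (subst suminf_mult[OF ternary_summable]) simp
  finally show ?thesis .
qed

text \<open>Digits 0 and 2 give the Cantor set: a leading 0 puts the number into [0, 1/3], a leading
  2 into [2/3, 1], and the same gap recurs at every scale. Binary digits would fail here, as two
  different expansions can have the same value.\<close>

lemma ternary_close_imp_eq:
  assumes "\<bar>ternary b - ternary b'\<bar> < 1 / 3 ^ n" "j < n"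
  shows "b j = b' j"
  using assms
proof (induction n arbitrary: b b' j)
  case (Suc n)
  let ?t = "ternary (\<lambda>j. b (Suc j))" and ?t' = "ternary (\<lambda>j. b' (Suc j))"
  have bnd: "0 \<le> ?t" "?t \<le> 1" "0 \<le> ?t'" "?t' \<le> 1"
    by (simp_all add: ternary_nonneg ternary_le_1)
  have "1 / 3 ^ Suc n \<le> (1 / 3 :: real)"
    by (simp add: field_simps)
  with Suc.prems(1) have less: "\<bar>ternary b - ternary b'\<bar> < 1 / 3" by linarith
  have head: "b 0 = b' 0"
    using less bnd unfolding ternary_shift[of b] ternary_shift[of b']
    by (cases "b 0"; cases "b' 0") (simp_all add: abs_less_iff)
  have "\<bar>?t - ?t'\<bar> < 1 / 3 ^ n"
    using Suc.prems(1) head unfolding ternary_shift[of b] ternary_shift[of b']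
    by (auto simp: abs_if field_simps split: if_splits)
  with head Suc show ?case by (cases j) auto
qed simp

text \<open>Finite nets at all scales 1/(n+1) are merged into one sequence of balls. Because each
  net is finite, a finite initial part of the sequence decides each scale, with one \<open>n\<close>
  for all pairs of points.\<close>

lemma compact_separating_open_sets:
  assumes "compact (UNIV :: 'a::metric_space set)"
  obtains B :: "nat \<Rightarrow> 'a::metric_space set" where "\<And>j. open (B j)"
    "\<And>e. e > 0 \<Longrightarrow> \<exists>n. \<forall>x y. (\<forall>j<n. x \<in> B j \<longleftrightarrow> y \<in> B j) \<longrightarrow> dist x y < e"
proof -
  have "\<exists>S :: 'a set. finite S \<and> (\<Union>c\<in>S. ball c (1 / Suc n)) = UNIV" for n
    using assms unfolding compact_eq_totally_bounded by (simp add: top.extremum_unique)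
  then obtain S :: "nat \<Rightarrow> 'a set" where S: "\<And>n. finite (S n)" "\<And>n. (\<Union>c\<in>S n. ball c (1 / Suc n)) = UNIV"
    by metis
  define \<B> where "\<B> = (\<Union>n. (\<lambda>c. ball c (1 / Suc n)) ` S n)"
  have "S 0 \<noteq> {}" using S(2)[of 0] by auto
  then have ne: "\<B> \<noteq> {}" by (auto simp: \<B>_def)
  have cnt: "countable \<B>"
    unfolding \<B>_def using S(1) by (simp add: countable_finite)
  define B where "B = from_nat_into \<B>"
  have ran: "range B = \<B>" using ne cnt by (simp add: B_def range_from_nat_into)
  show thesis
  proof
    show "open (B j)" for j using from_nat_into[OF ne, of j] by (auto simp: B_def \<B>_def)
    fix e :: real assume "e > 0"
    then obtain n where n: "1 / Suc n < e / 2"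
      using nat_approx_posE[of "e / 2"] by auto
    have "ball c (1 / Suc n) \<in> range B" if "c \<in> S n" for c
      unfolding ran using that by (auto simp: \<B>_def)
    then have "\<forall>c\<in>S n. \<exists>j. B j = ball c (1 / Suc n)" by (metis imageE)
    then obtain f where f: "\<And>c. c \<in> S n \<Longrightarrow> B (f c) = ball c (1 / Suc n)" by metis
    \<comment> \<open>The initial part reaches past the indices of all balls of the
      \<open>n\<close>-th net, so \<open>y\<close> shares a ball of radius below e/2 with
      \<open>x\<close>.\<close>
    have "dist x y < e" if xy: "\<forall>j<Suc (Max (f ` S n)). x \<in> B j \<longleftrightarrow> y \<in> B j" for x y
    proof -
      obtain c where c: "c \<in> S n" "x \<in> ball c (1 / Suc n)" using S(2)[of n] by blast
      moreover have "f c < Suc (Max (f ` S n))" using c(1) S(1) by (simp add: less_Suc_eq_le)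
      ultimately have "y \<in> ball c (1 / Suc n)" using xy f[OF c(1)] by auto
      with c n show ?thesis using dist_triangle2[of x y c] by (auto simp: dist_commute)
    qed
    then show "\<exists>n. \<forall>x y. (\<forall>j<n. x \<in> B j \<longleftrightarrow> y \<in> B j) \<longrightarrow> dist x y < e" by blast
  qed
qed

text \<open>The ternary digits of the code \<open>s x\<close> record which of the separating sets contain \<open>x\<close>. Close codes
  force close points, so the closure of the graph of \<open>s\<close> is the graph of an inverse map.\<close>

lemma compact_metric_real_coding:
  assumes "compact (UNIV :: 'a::metric_space set)"
  obtains s :: "'a::metric_space \<Rightarrow> real" and C h where "s \<in> borel_measurable borel" "compact C" "C \<subseteq> {0..1}"
    "range s \<subseteq> C" "continuous_on C h" "\<And>x. h (s x) = x"
proof -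
  obtain B :: "nat \<Rightarrow> 'a set" where B: "\<And>j. open (B j)"
    "\<And>e. e > 0 \<Longrightarrow> \<exists>n. \<forall>x y. (\<forall>j<n. x \<in> B j \<longleftrightarrow> y \<in> B j) \<longrightarrow> dist x y < e"
    by (rule compact_separating_open_sets[OF assms]) blast
  define s where "s x = ternary (\<lambda>j. x \<in> B j)" for x
  have s_range: "s x \<in> {0..1}" for x by (simp add: s_def ternary_nonneg ternary_le_1)
  have [measurable]: "B j \<in> sets borel" for j using B(1) by simp
  have s_meas: "s \<in> borel_measurable borel" unfolding s_def[abs_def] ternary_def by measurable
  \<comment> \<open>Uniform continuity of the inverse of \<open>s\<close> on its range;
    \<open>s\<close> itself is only measurable.\<close>
  have sep: "\<exists>d>0. \<forall>x y. \<bar>s x - s y\<bar> < d \<longrightarrow> dist x y < e" if e: "e > 0" for e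
  proof -
    obtain n where n: "\<forall>x y. (\<forall>j<n. x \<in> B j \<longleftrightarrow> y \<in> B j) \<longrightarrow> dist x y < e"
      using B(2)[OF e] by blast
    have "dist x y < e" if "\<bar>s x - s y\<bar> < 1 / 3 ^ n" for x y
      using n ternary_close_imp_eq[OF that[unfolded s_def]] by blast
    then show ?thesis by (intro exI[of _ "1 / 3 ^ n"]) auto
  qed
  define K where "K = closure (range (\<lambda>x. (s x, x)))"
  have "K \<subseteq> {0..1} \<times> UNIV"
    unfolding K_def using s_range by (intro closure_minimal closed_Times) auto
  moreover have "compact ({0..1::real} \<times> (UNIV :: 'a set))" by (intro compact_Times assms) auto
  ultimately have K: "compact K" by (metis K_def closed_closure compact_Int_closed inf.absorb_iff2)
  \<comment> \<open>\<open>sep\<close> passes to limits of points of the graph, so no two points of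
    the closure lie over the same real number.\<close>
  have inj: "inj_on fst K"
  proof (rule inj_onI)
    fix u v assume u: "u \<in> K" and v: "v \<in> K" and uv: "fst u = fst v"
    obtain U where U: "\<And>n. U n \<in> range (\<lambda>x. (s x, x))" "U \<longlonglongrightarrow> u"
      using u unfolding K_def closure_sequential by blast
    obtain V where V: "\<And>n. V n \<in> range (\<lambda>x. (s x, x))" "V \<longlonglongrightarrow> v"
      using v unfolding K_def closure_sequential by blast
    have Us: "fst (U n) = s (snd (U n))" and Vs: "fst (V n) = s (snd (V n))" for n
      using U(1)[of n] V(1)[of n] by auto
    have "(\<lambda>n. fst (U n) - fst (V n)) \<longlonglongrightarrow> fst u - fst v"
      using U V by (intro tendsto_intros)
    then have z: "(\<lambda>n. s (snd (U n)) - s (snd (V n))) \<longlonglongrightarrow> 0" using uv by (simp add: Us Vs)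
    have d: "(\<lambda>n. dist (snd (U n)) (snd (V n))) \<longlonglongrightarrow> dist (snd u) (snd v)"
      using U V by (intro tendsto_intros)
    have "dist (snd u) (snd v) \<le> e" if e: "e > 0" for e
    proof -
      obtain d' where "d' > 0" "\<forall>x y. \<bar>s x - s y\<bar> < d' \<longrightarrow> dist x y < e" using sep[OF e] by blast
      with tendstoD[OF z \<open>d' > 0\<close>]
      have "\<forall>\<^sub>F n in sequentially. dist (snd (U n)) (snd (V n)) \<le> e"
        by (auto simp: dist_real_def elim!: eventually_mono intro: less_imp_le)
      with d show ?thesis by (rule tendsto_upperbound) simp
    qed
    then have "dist (snd u) (snd v) \<le> 0" by (rule field_le_epsilon) simp
    then show "u = v" using uv by (intro prod_eqI) auto
  qed
  have sK: "(s x, x) \<in> K" for x unfolding K_def by (rule subsetD[OF closure_subset rangeI])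
  define h where "h t = snd (inv_into K fst t)" for t
  show thesis
  proof
    show "s \<in> borel_measurable borel" by (rule s_meas)
    show "compact (fst ` K)" by (intro compact_continuous_image K continuous_intros)
    show "fst ` K \<subseteq> {0..1}" using \<open>K \<subseteq> {0..1} \<times> UNIV\<close> by auto
    show "range s \<subseteq> fst ` K" using sK by force
    \<comment> \<open>A continuous injection on a compact set has a continuous inverse.\<close>
    have "continuous_on (fst ` K) (inv_into K fst)"
      using inj by (intro continuous_on_inv K continuous_intros) auto
    then show "continuous_on (fst ` K) h" unfolding h_def by (intro continuous_intros)
    show "h (s x) = x" for x using inv_into_f_f[OF inj sK[of x]] by (simp add: h_def)
  qed
qed

text \<open>The images under \<open>s\<close> live on one compact interval, hence are tight. Their
  limit \<open>N\<close> charges only \<open>C\<close>, so it can be carried back by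
  \<open>h\<close>; convergence is tested with \<open>f\<close> composed with \<open>h\<close>,
  which is continuous on \<open>C\<close>.\<close>

lemma weak_sequentially_compact:
  fixes \<xi> :: "nat \<Rightarrow> 'a::metric_space measure"
  assumes "compact (UNIV :: 'a set)" and \<xi>: "\<And>k. \<xi> k \<in> Xi UNIV"
  obtains r \<eta> where "strict_mono r" "\<eta> \<in> Xi UNIV" "limitin weak_topology (\<lambda>k. \<xi> (r k)) \<eta> sequentially"
proof -
  obtain s :: "'a \<Rightarrow> real" and C h where s[measurable]: "s \<in> borel_measurable borel"
    and C: "compact C" "C \<subseteq> {0..1}" "range s \<subseteq> C" and h: "continuous_on C h" "\<And>x. h (s x) = x"
    by (rule compact_metric_real_coding[OF assms(1)]) blast
  have C_ne: "C \<noteq> {}" using C(3) by auto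
  have C_closed: "closed C" by (rule compact_imp_closed[OF C(1)])
  have sets[measurable_cong]: "sets (\<xi> k) = sets borel" and prob: "prob_space (\<xi> k)" for k
    using \<xi>[of k] by (auto simp: Xi_UNIV)
  define \<nu> where "\<nu> k = distr (\<xi> k) borel s" for k
  have "prob_space (\<nu> k)" for k
    unfolding \<nu>_def by (intro prob_space.prob_space_distr prob) measurable
  then have real_dist: "real_distribution (\<nu> k)" for k
    by (simp add: real_distribution_def real_distribution_axioms_def \<nu>_def)
  have integral_\<nu>: "(\<integral>t. F t \<partial>\<nu> k) = (\<integral>x. F (s x) \<partial>\<xi> k)"
    if "F \<in> borel_measurable borel" for F :: "real \<Rightarrow> real" and k
    unfolding \<nu>_def using that by (intro integral_distr) measurable
  \<comment> \<open>Tightness is stated with half-open intervals; the left end -1 keeps the code 0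
    inside.\<close>
  have "measure (\<nu> k) {-1<..1} = 1" for k
  proof -
    have "s -` {-1<..1} \<inter> space (\<xi> k) = space (\<xi> k)"
      using C by (fastforce simp: subset_eq)
    then show ?thesis
      using prob_space.prob_space[OF prob] by (simp add: \<nu>_def measure_distr)
  qed
  then have "tight \<nu>"
    unfolding tight_def using real_dist by (intro conjI allI impI exI[of _ "-1"] exI[of _ 1]) auto
  then obtain r N where r: "strict_mono r" and N: "real_distribution N"
    and conv: "weak_conv_m (\<lambda>k. \<nu> (r k)) N"
    using tight_imp_convergent_subsubsequence[of \<nu> id] strict_mono_id by (auto simp: comp_def)
  interpret N: real_distribution N by fact
  have limit: "(\<lambda>k. \<integral>t. F t \<partial>\<nu> (r k)) \<longlonglongrightarrow> (\<integral>t. F t \<partial>N)"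
    if F: "continuous_on UNIV F" "\<And>t. norm (F t) \<le> B" for F :: "real \<Rightarrow> real" and B
    using F(1) by (intro weak_conv_imp_integral_bdd_continuous_conv[OF real_dist N conv _ F(2)])
       (auto simp: continuous_on_eq_continuous_at)
  \<comment> \<open>The truncated distance to \<open>C\<close> is a bounded continuous test function
    that vanishes on \<open>C\<close>. Its integrals are zero along the sequence, hence also for
    \<open>N\<close>, and \<open>C\<close> is closed.\<close>
  have AE_C: "AE t in N. t \<in> C"
  proof -
    let ?F = "\<lambda>t. min 1 (infdist t C)"
    have F: "continuous_on UNIV ?F" by (intro continuous_intros)
    have [measurable]: "?F \<in> borel_measurable borel" by (rule borel_measurable_continuous_onI[OF F])
    have bnd: "norm (?F t) \<le> 1" for t by (simp add: infdist_nonneg)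
    have "(\<integral>t. ?F t \<partial>\<nu> k) = 0" for k
      using C(3) by (subst integral_\<nu>) (auto simp: subset_eq)
    with limit[OF F bnd] have "(\<integral>t. ?F t \<partial>N) = 0" by (simp add: LIMSEQ_const_iff)
    moreover have "integrable N ?F" using bnd by (intro N.integrable_const_bound[where B = 1]) auto
    ultimately have "AE t in N. ?F t = 0"
      by (subst (asm) integral_nonneg_eq_0_iff_AE) (auto simp: infdist_nonneg)
    then show ?thesis
    proof eventually_elim
      case (elim t)
      then have "infdist t C = 0" by (auto simp: min_def split: if_splits)
      with C_closed C_ne show ?case by (simp add: in_closed_iff_infdist_zero)
    qed
  qed
  \<comment> \<open>A constant value off the \<open>N\<close>-null complement of \<open>C\<close>
    makes the inverse a Borel function on the whole line.\<close>
  define h' where "h' t = (if t \<in> C then h t else undefined)" for t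
  have h'[measurable]: "h' \<in> borel_measurable borel"
    unfolding h'_def[abs_def] using h(1) C_closed
    by (intro borel_measurable_continuous_on_if) auto
  define \<eta> where "\<eta> = distr N borel h'"
  have \<eta>: "\<eta> \<in> Xi UNIV"
    unfolding Xi_UNIV \<eta>_def using N.prob_space_distr[of h' borel] by simp
  have "(\<lambda>k. \<integral>x. f x \<partial>\<xi> (r k)) \<longlonglongrightarrow> (\<integral>x. f x \<partial>\<eta>)"
    if f: "continuous_on UNIV f" "bounded (range f)" for f :: "'a \<Rightarrow> real"
  proof -
    obtain B where B: "\<And>x. norm (f x) \<le> B" using f(2) by (auto simp: bounded_iff)
    have "0 \<le> B" using norm_ge_zero[of "f undefined"] B[of undefined] by linarith
    \<comment> \<open>Weak convergence on the line needs test functions on all reals; Tietze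
      supplies one with the same bound, and its values off \<open>C\<close> do not affect the
      integrals.\<close>
    have "continuous_on C (\<lambda>t. f (h t))"
      using continuous_on_compose2[OF f(1) h(1)] by auto
    then obtain F where F: "continuous_on UNIV F" "\<And>t. t \<in> C \<Longrightarrow> F t = f (h t)" "\<And>t. norm (F t) \<le> B"
      using Tietze[of C "\<lambda>t. f (h t)" UNIV B] C_closed \<open>0 \<le> B\<close> B by auto
    have [measurable]: "F \<in> borel_measurable borel" "f \<in> borel_measurable borel"
      using F(1) f(1) by (auto intro: borel_measurable_continuous_onI)
    have "(\<integral>t. F t \<partial>\<nu> k) = (\<integral>x. f x \<partial>\<xi> k)" for k
      using C(3) h(2) F(2) by (subst integral_\<nu>) (auto simp: subset_eq)
    moreover have "(\<integral>t. F t \<partial>N) = (\<integral>x. f x \<partial>\<eta>)"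
    proof -
      have "(\<integral>x. f x \<partial>\<eta>) = (\<integral>t. f (h' t) \<partial>N)"
        unfolding \<eta>_def by (rule integral_distr) measurable
      also have "\<dots> = (\<integral>t. F t \<partial>N)"
      proof (rule integral_cong_AE)
        show "AE t in N. f (h' t) = F t" using AE_C by eventually_elim (simp add: h'_def F(2))
      qed measurable
      finally show ?thesis ..
    qed
    ultimately show ?thesis using limit[OF F(1,3)] by simp
  qed
  then have "limitin weak_topology (\<lambda>k. \<xi> (r k)) \<eta> sequentially"
    using \<eta> \<xi> by (subst limitin_weak_topology) auto
  with r \<eta> show thesis by (rule that)
qed

subsection \<open>Affine functionals\<close>

lemma Xi_D:
  assumes "\<eta> \<in> Xi UNIV"
  shows "sets \<eta> = sets borel" "prob_space \<eta>" "space \<eta> = UNIV"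
  using assms sets_eq_imp_space_eq[of \<eta> borel] by (auto simp: Xi_UNIV)

lemma measure_mix:
  assumes "\<xi> \<in> Xi UNIV" "\<eta> \<in> Xi UNIV" "0 \<le> \<alpha>" "\<alpha> \<le> 1" "A \<in> sets borel"
  shows "measure (mix \<alpha> \<xi> \<eta>) A = (1 - \<alpha>) * measure \<xi> A + \<alpha> * measure \<eta> A"
proof -
  interpret \<xi>: prob_space \<xi> using assms Xi_D by blast
  interpret \<eta>: prob_space \<eta> using assms Xi_D by blast
  interpret m: prob_space "mix \<alpha> \<xi> \<eta>" using mix_in_Xi[OF assms(1-4)] Xi_D by blast
  have "emeasure (mix \<alpha> \<xi> \<eta>) A = ennreal (1 - \<alpha>) * emeasure \<xi> A + ennreal \<alpha> * emeasure \<eta> A"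
    using assms Xi_D(1)[OF assms(1)] Xi_D(1)[OF assms(2)] by (intro emeasure_mix) auto
  then have "ennreal (measure (mix \<alpha> \<xi> \<eta>) A) = ennreal ((1 - \<alpha>) * measure \<xi> A + \<alpha> * measure \<eta> A)"
    using assms(3,4)
    by (simp add: \<xi>.emeasure_eq_measure \<eta>.emeasure_eq_measure m.emeasure_eq_measure ennreal_mult ennreal_plus)
  then show ?thesis using assms(3,4) by (subst (asm) ennreal_inj) auto
qed

lemma Xi_iff_measure:
  assumes "A \<in> sets borel"
  shows "\<xi> \<in> Xi A \<longleftrightarrow> \<xi> \<in> Xi UNIV \<and> measure \<xi> A = 1"
proof (cases "\<xi> \<in> Xi UNIV")
  case True
  then interpret prob_space \<xi> by (rule Xi_D)
  show ?thesis using True assms by (simp add: Xi_eq emeasure_eq_measure)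
next
  case False
  then show ?thesis using Xi_eq[OF assms] by (auto simp: Xi_UNIV)
qed

lemma mix_in_Xi_on:
  assumes "A \<in> sets borel" "\<xi> \<in> Xi A" "\<eta> \<in> Xi A" "0 \<le> \<alpha>" "\<alpha> \<le> 1"
  shows "mix \<alpha> \<xi> \<eta> \<in> Xi A"
  using assms mix_in_Xi[of \<xi> \<eta> \<alpha>] measure_mix[of \<xi> \<eta> \<alpha> A] by (simp add: Xi_iff_measure[OF assms(1)])

lemma Xi_mono:
  assumes "A \<in> sets borel" "B \<in> sets borel" "A \<subseteq> B"
  shows "Xi A \<subseteq> Xi B"
proof
  fix \<xi> assume \<xi>: "\<xi> \<in> Xi A"
  then have U: "\<xi> \<in> Xi UNIV" "measure \<xi> A = 1" by (simp_all add: Xi_iff_measure[OF assms(1)])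
  interpret prob_space \<xi> using U(1) by (rule Xi_D)
  have "measure \<xi> A \<le> measure \<xi> B" using assms U(1) by (intro finite_measure_mono) (auto simp: Xi_D)
  with U show "\<xi> \<in> Xi B" by (simp add: Xi_iff_measure[OF assms(2)] antisym)
qed

lemma return_in_Xi:
  assumes "A \<in> sets borel" "a \<in> A"
  shows "return borel a \<in> Xi A"
  using assms by (simp add: Xi_eq prob_space_return)

text \<open>Affinity concerns two measures at a time, so one atom is split off per induction step:
  the measure is a mixture of the Dirac measure at \<open>a\<close> and its own conditioning on
  \<open>B\<close>.\<close>

lemma affine_finite_support:
  fixes \<Psi> :: "'a::t1_space measure \<Rightarrow> ereal"
  assumes aff: "affine_functional \<Psi>" and real: "\<And>\<eta>. \<eta> \<in> Xi UNIV \<Longrightarrow> \<bar>\<Psi> \<eta>\<bar> \<noteq> \<infinity>"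
    and "finite A" "\<eta> \<in> Xi UNIV" "measure \<eta> A = 1"
  shows "real_of_ereal (\<Psi> \<eta>) = (\<Sum>a\<in>A. measure \<eta> {a} * real_of_ereal (\<Psi> (return borel a)))"
  using assms(3-)
proof (induction A arbitrary: \<eta> rule: finite_induct)
  case (insert a B)
  interpret prob_space \<eta> using insert.prems(1) by (rule Xi_D)
  have sets[simp]: "sets \<eta> = sets borel" using insert.prems(1) by (rule Xi_D)
  have space[simp]: "space \<eta> = UNIV" using insert.prems(1) by (rule Xi_D)
  have fin[simp]: "F \<in> sets borel" if "finite F" for F :: "'a set"
    using finite_imp_closed[OF that] by simp
  have B[simp]: "B \<in> sets borel" using insert.hyps(1) by simp
  have split: "measure \<eta> C = measure \<eta> (C \<inter> {a}) + measure \<eta> (C \<inter> B)" if C: "C \<in> sets borel" for C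
  proof -
    have AE: "AE y in \<eta>. y \<in> insert a B"
      by (rule AE_prob_1) (use insert.prems(2) in simp)
    have "measure \<eta> C = measure \<eta> (C \<inter> insert a B)"
      using AE C insert.hyps(1) by (intro measure_eq_AE) auto
    also have "C \<inter> insert a B = (C \<inter> {a}) \<union> (C \<inter> B)" by auto
    also have "measure \<eta> \<dots> = measure \<eta> (C \<inter> {a}) + measure \<eta> (C \<inter> B)"
      using C insert.hyps by (intro finite_measure_Union) auto
    finally show ?thesis .
  qed
  define \<beta> where "\<beta> = measure \<eta> B"
  have \<beta>: "0 \<le> \<beta>" "\<beta> \<le> 1" by (simp_all add: \<beta>_def)
  have a: "measure \<eta> {a} = 1 - \<beta>"
    using split[of "insert a B"] insert by (simp add: \<beta>_def Int_absorb1 subset_insertI)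
  have ret: "return borel a \<in> Xi UNIV" by (rule return_in_Xi) auto
  have a_part: "measure \<eta> (C \<inter> {a}) = (1 - \<beta>) * indicator C a" for C
    by (cases "a \<in> C") (simp_all add: a)
  show ?case
  proof (cases "\<beta> = 0")
    case True
    have null: "measure \<eta> (C \<inter> B) = 0" if "C \<in> sets borel" for C
      using that finite_measure_mono[of "C \<inter> B" B] True by (simp add: \<beta>_def measure_le_0_iff)
    have "\<eta> = return borel a"
    proof (rule measure_eqI)
      fix C assume "C \<in> sets \<eta>"
      then show "emeasure \<eta> C = emeasure (return borel a) C"
        using split[of C] null[of C] a_part[of C] True
        by (simp add: emeasure_eq_measure split: split_indicator)
    qed simp
    moreover have "measure \<eta> {b} = 0" if "b \<in> B" for b
      using null[of "{b}"] that by (simp add: Int_absorb2)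
    ultimately show ?thesis using insert.hyps a True by simp
  next
    case False
    \<comment> \<open>\<open>uniform_measure \<eta> B\<close> is \<open>\<eta>\<close> conditioned
      on \<open>B\<close>, available because \<open>B\<close> has positive mass. Massless
      \<open>B\<close> was the Dirac case above.\<close>
    define \<rho> where "\<rho> = uniform_measure \<eta> B"
    have ne: "emeasure \<eta> B \<noteq> 0" using False by (simp add: \<beta>_def emeasure_eq_measure)
    have "prob_space \<rho>" unfolding \<rho>_def using ne by (intro prob_space_uniform_measure) auto
    then have \<rho>: "\<rho> \<in> Xi UNIV" by (simp add: Xi_UNIV \<rho>_def)
    have \<rho>_eq: "measure \<rho> C = measure \<eta> (B \<inter> C) / \<beta>" if "C \<in> sets borel" for C
      unfolding \<rho>_def \<beta>_def using that ne by (intro measure_uniform_measure) auto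
    have \<eta>_eq: "\<eta> = mix \<beta> (return borel a) \<rho>"
    proof (rule measure_eqI)
      fix C assume "C \<in> sets \<eta>"
      then have C: "C \<in> sets borel" by simp
      interpret m: prob_space "mix \<beta> (return borel a) \<rho>"
        using mix_in_Xi[OF ret \<rho> \<beta>] by (rule Xi_D)
      have "measure \<eta> C = measure (mix \<beta> (return borel a) \<rho>) C"
        using False C by (simp add: measure_mix[OF ret \<rho> \<beta> C] \<rho>_eq measure_return split[OF C] a_part Int_commute)
      then show "emeasure \<eta> C = emeasure (mix \<beta> (return borel a) \<rho>) C"
        by (simp add: emeasure_eq_measure m.emeasure_eq_measure)
    qed simp
    have "measure \<rho> B = 1" using False by (simp add: \<rho>_eq \<beta>_def)
    with insert.IH[OF \<rho>] have IH: "real_of_ereal (\<Psi> \<rho>) = (\<Sum>b\<in>B. measure \<rho> {b} * real_of_ereal (\<Psi> (return borel b)))" .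
    have "\<Psi> \<eta> = ereal (1 - \<beta>) * \<Psi> (return borel a) + ereal \<beta> * \<Psi> \<rho>"
      using aff ret \<rho> \<beta> unfolding \<eta>_eq affine_functional_def by auto
    then have "real_of_ereal (\<Psi> \<eta>) = (1 - \<beta>) * real_of_ereal (\<Psi> (return borel a)) + \<beta> * real_of_ereal (\<Psi> \<rho>)"
      using real[OF ret] real[OF \<rho>]
      by (cases "\<Psi> (return borel a)"; cases "\<Psi> \<rho>") auto
    also have "\<beta> * real_of_ereal (\<Psi> \<rho>) = (\<Sum>b\<in>B. measure \<eta> {b} * real_of_ereal (\<Psi> (return borel b)))"
      unfolding IH sum_distrib_left using False
      by (intro sum.cong) (auto simp: \<rho>_eq Int_absorb1)
    finally show ?thesis using insert.hyps a by simp
  qed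
qed simp

text \<open>Ranking the balls and taking the centre of the highest-ranked one that contains the
  point gives a Borel choice of a nearby centre. Pushing a measure forward along it makes the
  support finite.\<close>

lemma finite_cover_selection:
  fixes S :: "'a::metric_space set"
  assumes "finite S"
  obtains p :: "'a \<Rightarrow> 'a" where "p \<in> measurable borel borel" "finite (range p)"
    "\<And>y. y \<in> (\<Union>c\<in>S. ball c e) \<Longrightarrow> dist (p y) y < e"
proof -
  have "\<exists>p :: 'a \<Rightarrow> 'a. p \<in> measurable borel borel \<and> finite (range p) \<and>
    (\<forall>y\<in>(\<Union>c\<in>S. ball c e). dist (p y) y < e)"
    using assms
  proof induction
    case empty
    show ?case by (intro exI[of _ "\<lambda>_. undefined"]) auto
  next
    case (insert c S)
    then obtain p :: "'a \<Rightarrow> 'a" where p: "p \<in> measurable borel borel" "finite (range p)"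
      "\<forall>y\<in>(\<Union>c\<in>S. ball c e). dist (p y) y < e" by blast
    let ?p = "\<lambda>y. if y \<in> ball c e then c else p y"
    have "?p \<in> measurable borel borel" using p(1) by (intro measurable_If_set) auto
    moreover have "finite (range ?p)"
      by (rule finite_subset[of _ "insert c (range p)"]) (use p(2) in auto)
    ultimately show ?case using p(3) by (intro exI[of _ ?p]) auto
  qed
  then show thesis using that by blast
qed

lemma continuous_real_of_functional:
  fixes \<Psi> :: "'a::metric_space measure \<Rightarrow> ereal"
  assumes cont: "continuous_map weak_topology euclidean \<Psi>"
    and real: "\<And>\<eta>. \<eta> \<in> Xi UNIV \<Longrightarrow> \<bar>\<Psi> \<eta>\<bar> \<noteq> \<infinity>"
    and lim: "limitin weak_topology s \<eta> F"
  shows "((\<lambda>n. real_of_ereal (\<Psi> (s n))) \<longlongrightarrow> real_of_ereal (\<Psi> \<eta>)) F"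
proof -
  have "\<eta> \<in> Xi UNIV" using lim by (simp add: limitin_def)
  then have fin: "\<bar>\<Psi> \<eta>\<bar> \<noteq> \<infinity>" by (rule real)
  have "((\<lambda>n. \<Psi> (s n)) \<longlongrightarrow> \<Psi> \<eta>) F"
    using continuous_map_limit[OF cont lim] by (simp add: comp_def)
  then show ?thesis using lim_real_of_ereal[of "\<lambda>n. \<Psi> (s n)" "real_of_ereal (\<Psi> \<eta>)" F] fin
    by (simp add: ereal_real')
qed

lemma limitin_return:
  fixes y :: "'a::metric_space"
  assumes "(u \<longlongrightarrow> y) F"
  shows "limitin weak_topology (\<lambda>n. return borel (u n)) (return borel y) F"
proof (subst limitin_weak_topology)
  show "return borel (u n) \<in> Xi UNIV" for n by (rule return_in_Xi) auto
  have "((\<lambda>n. \<integral>x. f x \<partial>return borel (u n)) \<longlongrightarrow> (\<integral>x. f x \<partial>return borel y)) F"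
    if f: "continuous_on UNIV f" for f :: "'a \<Rightarrow> real"
  proof -
    have "f \<in> borel_measurable borel" using f by (rule borel_measurable_continuous_onI)
    moreover have "((\<lambda>n. f (u n)) \<longlongrightarrow> f y) F"
      using f assms continuous_on_tendsto_compose[of UNIV f u y F] by simp
    ultimately show ?thesis by (simp add: integral_return)
  qed
  then show "return borel y \<in> Xi UNIV \<and> (\<forall>f :: 'a \<Rightarrow> real. continuous_on UNIV f \<longrightarrow> bounded (range f) \<longrightarrow>
      ((\<lambda>n. \<integral>x. f x \<partial>return borel (u n)) \<longlongrightarrow> (\<integral>x. f x \<partial>return borel y)) F)"
    using return_in_Xi[of UNIV y] by auto
qed

lemma continuous_on_return:
  fixes \<Psi> :: "'a::metric_space measure \<Rightarrow> ereal"
  assumes "continuous_map weak_topology euclidean \<Psi>" "\<And>\<eta>. \<eta> \<in> Xi UNIV \<Longrightarrow> \<bar>\<Psi> \<eta>\<bar> \<noteq> \<infinity>"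
  shows "continuous_on UNIV (\<lambda>y. real_of_ereal (\<Psi> (return borel y)))"
  unfolding continuous_on_def
  by (auto intro!: continuous_real_of_functional[OF assms] limitin_return)

text \<open>Both sides are weakly continuous in \<open>\<eta>\<close> and agree on the finitely supported measures, which are
  weakly dense.\<close>

lemma affine_continuous_eq_integral:
  fixes \<Psi> :: "'a::metric_space measure \<Rightarrow> ereal"
  assumes compact: "compact (UNIV :: 'a set)"
    and cont: "continuous_map weak_topology euclidean \<Psi>"
    and real: "\<And>\<eta>. \<eta> \<in> Xi UNIV \<Longrightarrow> \<bar>\<Psi> \<eta>\<bar> \<noteq> \<infinity>"
    and aff: "affine_functional \<Psi>" and \<eta>: "\<eta> \<in> Xi UNIV"
  shows "real_of_ereal (\<Psi> \<eta>) = (\<integral>y. real_of_ereal (\<Psi> (return borel y)) \<partial>\<eta>)"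
proof -
  define \<phi> where "\<phi> y = real_of_ereal (\<Psi> (return borel y))" for y
  have \<phi>: "continuous_on UNIV \<phi>" unfolding \<phi>_def by (rule continuous_on_return[OF cont real])
  then have \<phi>_bdd: "bounded (range \<phi>)" using compact by (intro compact_imp_bounded compact_continuous_image)
  interpret prob_space \<eta> using \<eta> by (rule Xi_D)
  have [measurable_cong]: "sets \<eta> = sets borel" using \<eta> by (rule Xi_D)
  have "\<exists>S :: 'a set. finite S \<and> (\<Union>c\<in>S. ball c (1 / Suc n)) = UNIV" for n
    using compact unfolding compact_eq_totally_bounded by (simp add: top.extremum_unique)
  then have "\<exists>p :: 'a \<Rightarrow> 'a. p \<in> measurable borel borel \<and> finite (range p) \<and> (\<forall>y. dist (p y) y < 1 / Suc n)" for n
    using finite_cover_selection by (metis UNIV_I)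
  then obtain p :: "nat \<Rightarrow> 'a \<Rightarrow> 'a" where p[measurable]: "\<And>n. p n \<in> measurable borel borel"
    and p_fin: "\<And>n. finite (range (p n))" and p_dist: "\<And>n y. dist (p n y) y < 1 / Suc n" by metis
  have p_lim: "(\<lambda>n. p n y) \<longlonglongrightarrow> y" for y
  proof (subst tendsto_dist_iff, rule tendsto_sandwich[OF _ _ tendsto_const LIMSEQ_inverse_real_of_nat])
    show "\<forall>\<^sub>F n in sequentially. dist (p n y) y \<le> inverse (real (Suc n))"
      using p_dist[THEN less_imp_le] by (simp add: inverse_eq_divide)
  qed simp
  \<comment> \<open>Mass is moved by less than 1/(n+1), so these finitely supported measures
    converge weakly to \<open>\<eta>\<close>.\<close>
  define \<eta>n where "\<eta>n n = distr \<eta> borel (p n)" for n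
  have \<eta>n: "\<eta>n n \<in> Xi UNIV" for n
    unfolding Xi_UNIV \<eta>n_def using prob_space_distr[of "p n" borel] by simp
  have int: "(\<lambda>n. \<integral>y. f y \<partial>\<eta>n n) \<longlonglongrightarrow> (\<integral>y. f y \<partial>\<eta>)"
    if f: "continuous_on UNIV f" "bounded (range f)" for f :: "'a \<Rightarrow> real"
  proof -
    obtain B where B: "\<And>x. norm (f x) \<le> B" using f(2) by (auto simp: bounded_iff)
    have [measurable]: "f \<in> borel_measurable borel" using f(1) by (rule borel_measurable_continuous_onI)
    have "(\<lambda>n. \<integral>y. f (p n y) \<partial>\<eta>) \<longlonglongrightarrow> (\<integral>y. f y \<partial>\<eta>)"
    proof (rule integral_dominated_convergence[where w = "\<lambda>_. B"])
      show "AE y in \<eta>. (\<lambda>n. f (p n y)) \<longlonglongrightarrow> f y"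
        using continuous_on_tendsto_compose[OF f(1) p_lim] by simp
    qed (use B in auto)
    then show ?thesis unfolding \<eta>n_def by (subst integral_distr) auto
  qed
  have lim: "limitin weak_topology \<eta>n \<eta> sequentially"
    using \<eta> \<eta>n int by (subst limitin_weak_topology) auto
  have finite_case: "real_of_ereal (\<Psi> (\<eta>n n)) = (\<integral>y. \<phi> y \<partial>\<eta>n n)" for n
  proof -
    let ?A = "range (p n)"
    interpret n: prob_space "\<eta>n n" using \<eta>n by (rule Xi_D)
    have [simp]: "sets (\<eta>n n) = sets borel" by (simp add: \<eta>n_def)
    then have [measurable_cong]: "sets (\<eta>n n) = sets borel" .
    have A: "?A \<in> sets borel" using finite_imp_closed[OF p_fin] by simp
    have "p n -` ?A \<inter> space \<eta> = space \<eta>" by auto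
    then have A1: "measure (\<eta>n n) ?A = 1" using A prob_space by (simp add: \<eta>n_def measure_distr)
    have [measurable]: "\<phi> \<in> borel_measurable borel" using \<phi> by (rule borel_measurable_continuous_onI)
    have "(\<integral>y. \<phi> y \<partial>\<eta>n n) = (\<integral>y. (\<Sum>a\<in>?A. \<phi> a * indicator {a} y) \<partial>\<eta>n n)"
    proof (rule integral_cong_AE)
      have "AE y in \<eta>n n. y \<in> ?A" by (rule n.AE_prob_1) (rule A1)
      then show "AE y in \<eta>n n. \<phi> y = (\<Sum>a\<in>?A. \<phi> a * indicator {a} y)"
      proof eventually_elim
        case (elim y)
        have "(\<Sum>a\<in>?A. \<phi> a * indicator {a} y) = (\<Sum>a\<in>?A. if a = y then \<phi> a else 0)"
          by (intro sum.cong) (auto split: split_indicator)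
        then show ?case using elim p_fin by (simp add: sum.delta)
      qed
    qed measurable
    also have "\<dots> = (\<Sum>a\<in>?A. measure (\<eta>n n) {a} * \<phi> a)"
      by (subst Bochner_Integration.integral_sum) (auto simp: mult.commute n.emeasure_eq_measure)
    also have "\<dots> = real_of_ereal (\<Psi> (\<eta>n n))"
      unfolding \<phi>_def by (rule affine_finite_support[OF aff real p_fin \<eta>n A1, symmetric])
    finally show ?thesis by simp
  qed
  have "(\<lambda>n. \<integral>y. \<phi> y \<partial>\<eta>n n) \<longlonglongrightarrow> real_of_ereal (\<Psi> \<eta>)"
    using continuous_real_of_functional[OF cont real lim] unfolding finite_case .
  with int[OF \<phi> \<phi>_bdd] show ?thesis unfolding \<phi>_def by (metis LIMSEQ_unique)
qed

subsection \<open>Sensitivity functions and saddle points\<close>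

lemma fin_dom_real:
  assumes "\<And>\<eta>. \<eta> \<in> Xi UNIV \<Longrightarrow> \<Psi> \<eta> \<noteq> -\<infinity>" "\<eta> \<in> fin_dom \<Psi>"
  shows "ereal (real_of_ereal (\<Psi> \<eta>)) = \<Psi> \<eta>"
  using assms unfolding fin_dom_def by (cases "\<Psi> \<eta>") force+

text \<open>An infinite value at \<open>mix \<alpha> \<xi> \<eta>\<close> would make the quotient
  infinite, which is impossible near a real limit. Thus \<open>\<eta>\<close> may lie outside the
  domain, and the limit can be taken in the reals.\<close>

lemma sensitivity_real:
  assumes sens: "has_sensitivity \<Psi> \<psi>" and not_minf: "\<And>\<eta>. \<eta> \<in> Xi UNIV \<Longrightarrow> \<Psi> \<eta> \<noteq> -\<infinity>"
    and \<xi>: "\<xi> \<in> fin_dom \<Psi>" and \<eta>: "\<eta> \<in> Xi UNIV"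
  shows "\<forall>\<^sub>F \<alpha> in at_right 0. mix \<alpha> \<xi> \<eta> \<in> fin_dom \<Psi>"
    and "((\<lambda>\<alpha>. (real_of_ereal (\<Psi> (mix \<alpha> \<xi> \<eta>)) - real_of_ereal (\<Psi> \<xi>)) / \<alpha>) \<longlongrightarrow> (\<integral>x. \<psi> \<xi> x \<partial>\<eta>)) (at_right 0)"
proof -
  let ?q = "\<lambda>\<alpha>. (\<Psi> (mix \<alpha> \<xi> \<eta>) - \<Psi> \<xi>) / ereal \<alpha>"
  have lim: "(?q \<longlongrightarrow> ereal (\<integral>x. \<psi> \<xi> x \<partial>\<eta>)) (at_right 0)"
    using sens \<xi> \<eta> by (auto simp: has_sensitivity_def)
  have \<xi>_real: "ereal (real_of_ereal (\<Psi> \<xi>)) = \<Psi> \<xi>" by (rule fin_dom_real[OF not_minf \<xi>])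
  have "\<forall>\<^sub>F \<alpha> in at_right 0. ?q \<alpha> < \<infinity>"
    by (rule order_tendstoD(2)[OF lim]) simp
  moreover have small: "\<forall>\<^sub>F \<alpha> in at_right (0::real). 0 < \<alpha> \<and> \<alpha> < 1"
    by (rule eventually_at_rightI[of 0 1]) auto
  ultimately show fin: "\<forall>\<^sub>F \<alpha> in at_right 0. mix \<alpha> \<xi> \<eta> \<in> fin_dom \<Psi>"
  proof eventually_elim
    case (elim \<alpha>)
    have "mix \<alpha> \<xi> \<eta> \<in> Xi UNIV" using elim \<xi> \<eta> by (intro mix_in_Xi) (auto simp: fin_dom_def)
    moreover have "\<Psi> (mix \<alpha> \<xi> \<eta>) \<noteq> \<infinity>"
    proof
      assume "\<Psi> (mix \<alpha> \<xi> \<eta>) = \<infinity>"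
      then have "?q \<alpha> = \<infinity>" using elim \<xi>_real by (cases "\<Psi> \<xi>") auto
      with elim show False by simp
    qed
    ultimately show ?case by (simp add: fin_dom_def less_top[symmetric] top_ereal_def)
  qed
  have "\<forall>\<^sub>F \<alpha> in at_right 0. ?q \<alpha> = ereal ((real_of_ereal (\<Psi> (mix \<alpha> \<xi> \<eta>)) - real_of_ereal (\<Psi> \<xi>)) / \<alpha>)"
    using fin small
  proof eventually_elim
    case (elim \<alpha>)
    then show ?case
      using fin_dom_real[OF not_minf elim(1)] \<xi>_real
      by (cases "\<Psi> (mix \<alpha> \<xi> \<eta>)"; cases "\<Psi> \<xi>") auto
  qed
  then have "((\<lambda>\<alpha>. ereal ((real_of_ereal (\<Psi> (mix \<alpha> \<xi> \<eta>)) - real_of_ereal (\<Psi> \<xi>)) / \<alpha>))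
      \<longlongrightarrow> ereal (\<integral>x. \<psi> \<xi> x \<partial>\<eta>)) (at_right 0)"
    using lim by (rule Lim_transform_eventually[rotated])
  then show "((\<lambda>\<alpha>. (real_of_ereal (\<Psi> (mix \<alpha> \<xi> \<eta>)) - real_of_ereal (\<Psi> \<xi>)) / \<alpha>) \<longlongrightarrow> (\<integral>x. \<psi> \<xi> x \<partial>\<eta>)) (at_right 0)"
    by simp
qed

text \<open>By convexity each difference quotient is at most \<Psi>(\<eta>) - \<Psi>(\<xi>), and so
  is its limit, the integral of the sensitivity.\<close>

lemma convex_subgradient:
  assumes conv: "convex_functional \<Psi>" and sens: "has_sensitivity \<Psi> \<psi>"
    and not_minf: "\<And>\<eta>. \<eta> \<in> Xi UNIV \<Longrightarrow> \<Psi> \<eta> \<noteq> -\<infinity>"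
    and \<xi>: "\<xi> \<in> fin_dom \<Psi>" and \<eta>: "\<eta> \<in> fin_dom \<Psi>"
  shows "real_of_ereal (\<Psi> \<xi>) + (\<integral>x. \<psi> \<xi> x \<partial>\<eta>) \<le> real_of_ereal (\<Psi> \<eta>)"
proof -
  have Xi: "\<xi> \<in> Xi UNIV" "\<eta> \<in> Xi UNIV" using \<xi> \<eta> by (auto simp: fin_dom_def)
  have mix_fin: "\<forall>\<^sub>F \<alpha> in at_right 0. mix \<alpha> \<xi> \<eta> \<in> fin_dom \<Psi>"
    by (rule sensitivity_real(1)[OF sens not_minf \<xi> Xi(2)])
  have real: "ereal (real_of_ereal (\<Psi> \<zeta>)) = \<Psi> \<zeta>" if "\<zeta> \<in> fin_dom \<Psi>" for \<zeta>
    by (rule fin_dom_real[OF not_minf that])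
  have small: "\<forall>\<^sub>F \<alpha> in at_right (0::real). 0 < \<alpha> \<and> \<alpha> < 1"
    by (rule eventually_at_rightI[of 0 1]) auto
  have "\<forall>\<^sub>F \<alpha> in at_right 0. (real_of_ereal (\<Psi> (mix \<alpha> \<xi> \<eta>)) - real_of_ereal (\<Psi> \<xi>)) / \<alpha>
      \<le> real_of_ereal (\<Psi> \<eta>) - real_of_ereal (\<Psi> \<xi>)"
    using mix_fin small
  proof eventually_elim
    case (elim \<alpha>)
    have "\<Psi> (mix \<alpha> \<xi> \<eta>) \<le> ereal (1 - \<alpha>) * \<Psi> \<xi> + ereal \<alpha> * \<Psi> \<eta>"
      using conv Xi elim by (auto simp: convex_functional_def)
    then have "real_of_ereal (\<Psi> (mix \<alpha> \<xi> \<eta>)) \<le> (1 - \<alpha>) * real_of_ereal (\<Psi> \<xi>) + \<alpha> * real_of_ereal (\<Psi> \<eta>)"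
      using real[OF elim(1)] real[OF \<xi>] real[OF \<eta>]
      by (metis ereal_less_eq(3) plus_ereal.simps(1) times_ereal.simps(1))
    then show ?case using elim by (simp add: field_simps)
  qed
  moreover have "((\<lambda>\<alpha>. (real_of_ereal (\<Psi> (mix \<alpha> \<xi> \<eta>)) - real_of_ereal (\<Psi> \<xi>)) / \<alpha>)
      \<longlongrightarrow> (\<integral>x. \<psi> \<xi> x \<partial>\<eta>)) (at_right 0)"
    by (rule sensitivity_real(2)[OF sens not_minf \<xi> Xi(2)])
  ultimately have "(\<integral>x. \<psi> \<xi> x \<partial>\<eta>) \<le> real_of_ereal (\<Psi> \<eta>) - real_of_ereal (\<Psi> \<xi>)"
    by (intro tendsto_upperbound) auto
  then show ?thesis by simp
qed

lemma affine_imp_convex: "affine_functional \<Psi> \<Longrightarrow> convex_functional \<Psi>"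
  by (simp add: affine_functional_def convex_functional_def)

lemma affine_mix_real:
  assumes "affine_functional \<Psi>" "\<And>\<eta>. \<eta> \<in> Xi UNIV \<Longrightarrow> \<bar>\<Psi> \<eta>\<bar> \<noteq> \<infinity>"
    "\<xi> \<in> Xi UNIV" "\<eta> \<in> Xi UNIV" "0 \<le> \<alpha>" "\<alpha> \<le> 1"
  shows "real_of_ereal (\<Psi> (mix \<alpha> \<xi> \<eta>)) = (1 - \<alpha>) * real_of_ereal (\<Psi> \<xi>) + \<alpha> * real_of_ereal (\<Psi> \<eta>)"
proof -
  have "\<Psi> (mix \<alpha> \<xi> \<eta>) = ereal (1 - \<alpha>) * \<Psi> \<xi> + ereal \<alpha> * \<Psi> \<eta>"
    using assms by (auto simp: affine_functional_def)
  then show ?thesis using assms(2)[OF assms(3)] assms(2)[OF assms(4)]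
    by (cases "\<Psi> \<xi>"; cases "\<Psi> \<eta>") auto
qed

text \<open>Along a segment the difference quotient of an affine functional is constant, and the
  integral representation identifies the constant. The resulting identity, unlike a subgradient
  inequality, survives multiplication by a negative multiplier.\<close>

lemma affine_sensitivity:
  fixes \<Psi> :: "'a::metric_space measure \<Rightarrow> ereal"
  assumes compact: "compact (UNIV :: 'a set)"
    and cont: "continuous_map weak_topology euclidean \<Psi>"
    and real: "\<And>\<eta>. \<eta> \<in> Xi UNIV \<Longrightarrow> \<bar>\<Psi> \<eta>\<bar> \<noteq> \<infinity>"
    and aff: "affine_functional \<Psi>"
    and \<psi>: "\<And>\<eta> y. \<eta> \<in> Xi UNIV \<Longrightarrow> \<psi> \<eta> y = real_of_ereal (\<Psi> (return borel y)) - real_of_ereal (\<Psi> \<eta>)"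
  shows "has_sensitivity \<Psi> \<psi>"
    and "\<xi> \<in> Xi UNIV \<Longrightarrow> \<eta> \<in> Xi UNIV \<Longrightarrow>
      real_of_ereal (\<Psi> \<xi>) + (\<integral>x. \<psi> \<xi> x \<partial>\<eta>) = real_of_ereal (\<Psi> \<eta>)"
proof -
  let ?\<phi> = "\<lambda>y. real_of_ereal (\<Psi> (return borel y))"
  have \<phi>: "continuous_on UNIV ?\<phi>" by (rule continuous_on_return[OF cont real])
  then have "bounded (range ?\<phi>)" using compact by (intro compact_imp_bounded compact_continuous_image)
  then obtain B where B: "\<And>y. norm (?\<phi> y) \<le> B" by (auto simp: bounded_iff)
  have \<phi>_int: "integrable \<eta> ?\<phi>" if "\<eta> \<in> Xi UNIV" for \<eta>
  proof -
    interpret prob_space \<eta> using that by (rule Xi_D)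
    have [measurable_cong]: "sets \<eta> = sets borel" using that by (rule Xi_D)
    have "?\<phi> \<in> borel_measurable borel" using \<phi> by (rule borel_measurable_continuous_onI)
    then show ?thesis using B by (intro integrable_const_bound[where B = B]) auto
  qed
  have int: "integrable \<eta> (\<psi> \<xi>)" and eq: "(\<integral>x. \<psi> \<xi> x \<partial>\<eta>) = real_of_ereal (\<Psi> \<eta>) - real_of_ereal (\<Psi> \<xi>)"
    if \<xi>: "\<xi> \<in> Xi UNIV" and \<eta>: "\<eta> \<in> Xi UNIV" for \<xi> \<eta>
  proof -
    interpret prob_space \<eta> using \<eta> by (rule Xi_D)
    have \<psi>': "\<psi> \<xi> = (\<lambda>y. ?\<phi> y - real_of_ereal (\<Psi> \<xi>))" using \<psi>[OF \<xi>] by auto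
    show "integrable \<eta> (\<psi> \<xi>)" unfolding \<psi>' using \<phi>_int[OF \<eta>] by auto
    show "(\<integral>x. \<psi> \<xi> x \<partial>\<eta>) = real_of_ereal (\<Psi> \<eta>) - real_of_ereal (\<Psi> \<xi>)"
      unfolding \<psi>' using \<phi>_int[OF \<eta>] affine_continuous_eq_integral[OF compact cont real aff \<eta>] prob_space
      by simp
  qed
  then show "\<xi> \<in> Xi UNIV \<Longrightarrow> \<eta> \<in> Xi UNIV \<Longrightarrow>
      real_of_ereal (\<Psi> \<xi>) + (\<integral>x. \<psi> \<xi> x \<partial>\<eta>) = real_of_ereal (\<Psi> \<eta>)" by simp
  have "((\<lambda>\<alpha>. (\<Psi> (mix \<alpha> \<xi> \<eta>) - \<Psi> \<xi>) / ereal \<alpha>) \<longlongrightarrow> ereal (\<integral>x. \<psi> \<xi> x \<partial>\<eta>)) (at_right 0)"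
    if \<xi>: "\<xi> \<in> Xi UNIV" and \<eta>: "\<eta> \<in> Xi UNIV" for \<xi> \<eta>
  proof (rule tendsto_eventually, rule eventually_at_rightI[of 0 1])
    fix \<alpha> :: real assume \<alpha>: "\<alpha> \<in> {0<..<1}"
    then have "mix \<alpha> \<xi> \<eta> \<in> Xi UNIV" using \<xi> \<eta> by (intro mix_in_Xi) auto
    then have "(\<Psi> (mix \<alpha> \<xi> \<eta>) - \<Psi> \<xi>) / ereal \<alpha> = ereal ((real_of_ereal (\<Psi> (mix \<alpha> \<xi> \<eta>)) - real_of_ereal (\<Psi> \<xi>)) / \<alpha>)"
      using real[OF \<xi>] real[of "mix \<alpha> \<xi> \<eta>"] \<alpha>
      by (cases "\<Psi> \<xi>"; cases "\<Psi> (mix \<alpha> \<xi> \<eta>)") auto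
    also have "real_of_ereal (\<Psi> (mix \<alpha> \<xi> \<eta>)) - real_of_ereal (\<Psi> \<xi>) = \<alpha> * (real_of_ereal (\<Psi> \<eta>) - real_of_ereal (\<Psi> \<xi>))"
      using affine_mix_real[OF aff real \<xi> \<eta>, of \<alpha>] \<alpha> by (simp add: algebra_simps)
    finally show "(\<Psi> (mix \<alpha> \<xi> \<eta>) - \<Psi> \<xi>) / ereal \<alpha> = ereal (\<integral>x. \<psi> \<xi> x \<partial>\<eta>)"
      using \<alpha> eq[OF \<xi> \<eta>] by simp
  qed simp
  with int show "has_sensitivity \<Psi> \<psi>" by (auto simp: has_sensitivity_def fin_dom_def)
qed

section \<open>Lagrangian, saddle points and first-order conditions on a fixed
  discretization\<close>

locale measure_program =
  fixes \<Psi> :: "'i::zero \<Rightarrow> 'a::metric_space measure \<Rightarrow> ereal"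
    and \<psi> :: "'i \<Rightarrow> 'a measure \<Rightarrow> 'a \<Rightarrow> real"
    and Iineq Ieq :: "'i set"
  assumes index_sets: "finite Iineq" "finite Ieq" "Iineq \<inter> Ieq = {}" "0 \<notin> Iineq \<union> Ieq"
    and not_minf: "\<And>i \<eta>. i \<in> insert 0 (Iineq \<union> Ieq) \<Longrightarrow> \<eta> \<in> Xi UNIV \<Longrightarrow> \<Psi> i \<eta> \<noteq> -\<infinity>"
    and eq_real: "\<And>i \<eta>. i \<in> Ieq \<Longrightarrow> \<eta> \<in> Xi UNIV \<Longrightarrow> \<bar>\<Psi> i \<eta>\<bar> \<noteq> \<infinity>"
    and convex: "\<And>i. i \<in> insert 0 (Iineq \<union> Ieq) \<Longrightarrow> convex_functional (\<Psi> i)"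
    and sens: "\<And>i. i \<in> insert 0 (Iineq \<union> Ieq) \<Longrightarrow> has_sensitivity (\<Psi> i) (\<psi> i)"
    and eq_affine: "\<And>i. i \<in> Ieq \<Longrightarrow> affine_functional (\<Psi> i)"
    and eq_integral: "\<And>i \<xi> \<eta>. i \<in> Ieq \<Longrightarrow> \<xi> \<in> Xi UNIV \<Longrightarrow> \<eta> \<in> Xi UNIV \<Longrightarrow>
      real_of_ereal (\<Psi> i \<xi>) + (\<integral>x. \<psi> i \<xi> x \<partial>\<eta>) = real_of_ereal (\<Psi> i \<eta>)"
begin

abbreviation P :: "'i \<Rightarrow> 'a measure \<Rightarrow> real" where "P i \<eta> \<equiv> real_of_ereal (\<Psi> i \<eta>)"
abbreviation I where "I \<equiv> Iineq \<union> Ieq"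
abbreviation feas where "feas \<equiv> Xi_feas \<Psi> Iineq Ieq"
abbreviation fin where "fin \<equiv> Xi_fin \<Psi> Iineq Ieq"
abbreviation saddle where "saddle \<equiv> saddle_point \<Psi> Iineq Ieq"
abbreviation mult where "mult \<equiv> multipliers Iineq Ieq"
abbreviation \<psi>L where "\<psi>L \<equiv> Lagrangian_sensitivity \<psi> Iineq Ieq"

text \<open>A real version for calculations. It represents \<open>Lagrangian\<close> only at
  measures in \<open>fin UNIV\<close>, since \<open>real_of_ereal\<close> sends infinite values to
  0.\<close>

definition L :: "'a measure \<Rightarrow> ('i \<Rightarrow> real) \<Rightarrow> real"
  where "L \<eta> l = P 0 \<eta> + (\<Sum>i\<in>I. l i * P i \<eta>)"

lemma finite_I: "finite I" using index_sets by simp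

lemma fin_iff:
  assumes "A \<in> sets borel"
  shows "\<eta> \<in> fin A \<longleftrightarrow> \<eta> \<in> Xi A \<and> \<eta> \<in> fin UNIV"
  using Xi_iff_measure[OF assms] by (auto simp: Xi_fin_def)

lemma fin_UNIV: "\<eta> \<in> fin UNIV \<longleftrightarrow> (\<forall>i\<in>insert 0 I. \<eta> \<in> fin_dom (\<Psi> i))"
  by (auto simp: Xi_fin_def fin_dom_def)

lemma fin_real:
  assumes "\<eta> \<in> fin UNIV" "i \<in> insert 0 I"
  shows "ereal (P i \<eta>) = \<Psi> i \<eta>"
  by (rule fin_dom_real[OF not_minf[OF assms(2)]]) (use assms fin_UNIV in auto)

lemma Lagrangian_eq:
  assumes "\<eta> \<in> fin UNIV"
  shows "Lagrangian \<Psi> Iineq Ieq \<eta> l = ereal (L \<eta> l)"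
proof -
  have "(\<Sum>i\<in>I. ereal (l i) * \<Psi> i \<eta>) = (\<Sum>i\<in>I. ereal (l i * P i \<eta>))"
    by (intro sum.cong refl) (use fin_real[OF assms] in \<open>metis insertI2 times_ereal.simps(1)\<close>)
  then show ?thesis
    unfolding Lagrangian_def L_def by (simp add: fin_real[OF assms] flip: plus_ereal.simps(1))
qed

lemma mult_iff:
  "l \<in> mult \<longleftrightarrow> l \<in> extensional I \<and> (\<forall>i\<in>Iineq. 0 \<le> l i)"
  unfolding multipliers_def by (auto simp: PiE_iff)

text \<open>Changing one multiplier by \<open>t\<close> changes the Lagrangian by
  \<open>t * P i \<xi>\<close>, which maximality in the multiplier keeps nonpositive. The choice t =
  1 gives the inequality constraints, t = 1 and t = -1 the equality constraints.\<close>

lemma saddle_properties: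
  assumes A: "A \<in> sets borel" and "saddle A \<xi> l"
  shows "\<xi> \<in> fin UNIV" "l \<in> mult" "\<xi> \<in> feas A" "L \<xi> l = P 0 \<xi>"
    "\<And>\<eta>. \<eta> \<in> fin A \<Longrightarrow> L \<xi> l \<le> L \<eta> l"
proof -
  have \<xi>A: "\<xi> \<in> fin A" and l: "l \<in> mult" using assms(2) by (auto simp: saddle_point_def)
  show \<xi>: "\<xi> \<in> fin UNIV" using \<xi>A fin_iff[OF A] by blast
  show "l \<in> mult" by fact
  show "L \<xi> l \<le> L \<eta> l" if "\<eta> \<in> fin A" for \<eta>
  proof -
    have "\<eta> \<in> fin UNIV" using that fin_iff[OF A] by blast
    then show ?thesis using assms(2) that l \<xi> by (auto simp: saddle_point_def Lagrangian_eq)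
  qed
  have max: "(\<Sum>i\<in>I. l' i * P i \<xi>) \<le> (\<Sum>i\<in>I. l i * P i \<xi>)" if "l' \<in> mult" for l'
  proof -
    have "Lagrangian \<Psi> Iineq Ieq \<xi> l' \<le> Lagrangian \<Psi> Iineq Ieq \<xi> l"
      using assms(2) that \<xi>A by (auto simp: saddle_point_def)
    then show ?thesis by (simp add: Lagrangian_eq[OF \<xi>] L_def)
  qed
  have shift: "t * P i \<xi> \<le> 0" if "i \<in> I" "l(i := l i + t) \<in> mult" for i t
  proof -
    have "(\<Sum>j\<in>I. (l(i := l i + t)) j * P j \<xi>) = (\<Sum>j\<in>I. l j * P j \<xi> + (if j = i then t * P i \<xi> else 0))"
      by (intro sum.cong) (auto simp: algebra_simps)
    also have "\<dots> = (\<Sum>j\<in>I. l j * P j \<xi>) + t * P i \<xi>"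
      using that(1) finite_I by (simp add: sum.distrib)
    finally show ?thesis using max[OF that(2)] by simp
  qed
  have ineq: "P i \<xi> \<le> 0" if "i \<in> Iineq" for i
    using shift[of i 1] that l by (auto simp: mult_iff extensional_def)
  have eq: "P i \<xi> = 0" if "i \<in> Ieq" for i
  proof -
    have "l(i := l i + t) \<in> mult" for t
      using that l index_sets(3) by (auto simp: mult_iff extensional_def)
    then have "t * P i \<xi> \<le> 0" for t using that shift by blast
    from this[of 1] this[of "-1"] show ?thesis by linarith
  qed
  show "\<xi> \<in> feas A"
    using \<xi>A ineq eq fin_real[OF \<xi>] unfolding Xi_feas_def Xi_fin_def
    by (auto simp: zero_ereal_def simp flip: ereal_less_eq(3)) (metis UnCI insertCI)+
  \<comment> \<open>Comparison with the zero multiplier yields complementary slackness.\<close>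
  have "0 \<le> (\<Sum>i\<in>I. l i * P i \<xi>)"
    using max[of "\<lambda>i\<in>I. 0"] by (simp add: mult_iff)
  moreover have "(\<Sum>i\<in>I. l i * P i \<xi>) \<le> 0"
    using ineq eq l by (intro sum_nonpos) (auto simp: mult_iff mult_nonneg_nonpos)
  ultimately show "L \<xi> l = P 0 \<xi>" by (simp add: L_def)
qed

lemma feasible_fin:
  assumes A: "A \<in> sets borel" and "\<eta> \<in> feas A" "\<Psi> 0 \<eta> < \<infinity>"
  shows "\<eta> \<in> fin A"
proof -
  have "\<eta> \<in> Xi UNIV" using assms Xi_iff_measure[OF A] by (auto simp: Xi_feas_def)
  moreover have "\<Psi> i \<eta> < \<infinity>" if "i \<in> I" for i
    using assms(2) that unfolding Xi_feas_def by (auto intro: le_less_trans)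
  ultimately show ?thesis using assms by (auto simp: Xi_fin_def fin_dom_def Xi_feas_def)
qed

lemma feasible_L_le:
  assumes "\<eta> \<in> feas A" "\<eta> \<in> fin UNIV" "l \<in> mult"
  shows "L \<eta> l \<le> P 0 \<eta>"
proof -
  have "l i * P i \<eta> \<le> 0" if "i \<in> I" for i
  proof (cases "i \<in> Ieq")
    case True
    then show ?thesis using assms(1) by (simp add: Xi_feas_def)
  next
    case False
    then have "0 \<le> l i" "\<Psi> i \<eta> \<le> 0" using that assms by (auto simp: mult_iff Xi_feas_def)
    then show ?thesis by (intro mult_nonneg_nonpos) (auto simp: real_of_ereal_le_0)
  qed
  then show ?thesis unfolding L_def using sum_nonpos[of I "\<lambda>i. l i * P i \<eta>"] by simp
qed

lemma integral_\<psi>L: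
  assumes "\<xi> \<in> fin UNIV" "\<eta> \<in> Xi UNIV"
  shows "integrable \<eta> (\<psi>L \<xi> l)"
    "(\<integral>x. \<psi>L \<xi> l x \<partial>\<eta>) = (\<integral>x. \<psi> 0 \<xi> x \<partial>\<eta>) + (\<Sum>i\<in>I. l i * (\<integral>x. \<psi> i \<xi> x \<partial>\<eta>))"
proof -
  have int: "integrable \<eta> (\<psi> i \<xi>)" if "i \<in> insert 0 I" for i
    using sens[OF that] assms that fin_UNIV by (auto simp: has_sensitivity_def)
  then have int': "integrable \<eta> (\<lambda>x. l i * \<psi> i \<xi> x)" if "i \<in> I" for i
    using that by (intro integrable_mult_right) auto
  show "integrable \<eta> (\<psi>L \<xi> l)" unfolding Lagrangian_sensitivity_def[abs_def]
    using int int' by (intro Bochner_Integration.integrable_add Bochner_Integration.integrable_sum) auto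
  show "(\<integral>x. \<psi>L \<xi> l x \<partial>\<eta>) = (\<integral>x. \<psi> 0 \<xi> x \<partial>\<eta>) + (\<Sum>i\<in>I. l i * (\<integral>x. \<psi> i \<xi> x \<partial>\<eta>))"
    unfolding Lagrangian_sensitivity_def using int int'
    by (subst Bochner_Integration.integral_add, simp, intro Bochner_Integration.integrable_sum, simp)
       (subst Bochner_Integration.integral_sum, auto)
qed

lemma L_subgradient:
  assumes \<xi>: "\<xi> \<in> fin UNIV" and \<eta>: "\<eta> \<in> fin UNIV" and l: "l \<in> mult"
  shows "L \<xi> l + (\<integral>x. \<psi>L \<xi> l x \<partial>\<eta>) \<le> L \<eta> l"
proof -
  have Xi: "\<xi> \<in> Xi UNIV" "\<eta> \<in> Xi UNIV" using \<xi> \<eta> by (auto simp: Xi_fin_def)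
  have sub: "P i \<xi> + (\<integral>x. \<psi> i \<xi> x \<partial>\<eta>) \<le> P i \<eta>" if "i \<in> insert 0 I" for i
    using \<xi> \<eta> that fin_UNIV by (intro convex_subgradient convex sens not_minf) auto
  have "l i * P i \<xi> + l i * (\<integral>x. \<psi> i \<xi> x \<partial>\<eta>) \<le> l i * P i \<eta>" if "i \<in> I" for i
  proof (cases "i \<in> Ieq")
    case True
    \<comment> \<open>The multiplier may be negative here, so the exact identity replaces the
      subgradient inequality.\<close>
    then show ?thesis using eq_integral[OF True Xi] by (metis distrib_left order_refl)
  next
    case False
    then have "0 \<le> l i" using that l by (auto simp: mult_iff)
    then show ?thesis using mult_left_mono[OF sub[of i], of "l i"] that by (simp add: distrib_left)
  qed
  then have "(\<Sum>i\<in>I. l i * P i \<xi> + l i * (\<integral>x. \<psi> i \<xi> x \<partial>\<eta>)) \<le> (\<Sum>i\<in>I. l i * P i \<eta>)"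
    by (rule sum_mono)
  with sub[of 0] show ?thesis
    unfolding L_def integral_\<psi>L(2)[OF \<xi> Xi(2)] by (simp add: sum.distrib)
qed

text \<open>Finitely many domains are involved, so their initial segments have a common one. Only
  \<open>\<xi>\<close> has to have finite values, not the target \<open>\<eta>\<close>.\<close>

lemma eventually_mix_fin:
  assumes A: "A \<in> sets borel" and \<xi>: "\<xi> \<in> fin A" and \<eta>: "\<eta> \<in> Xi A"
  shows "\<forall>\<^sub>F \<alpha> in at_right 0. mix \<alpha> \<xi> \<eta> \<in> fin A"
proof -
  have \<xi>': "\<xi> \<in> Xi A" "\<xi> \<in> fin UNIV" using \<xi> fin_iff[OF A] by auto
  have \<eta>': "\<eta> \<in> Xi UNIV" using \<eta> Xi_iff_measure[OF A] by blast
  have "\<forall>\<^sub>F \<alpha> in at_right 0. \<forall>i\<in>insert 0 I. mix \<alpha> \<xi> \<eta> \<in> fin_dom (\<Psi> i)"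
    using finite_I \<xi>'(2) \<eta>' fin_UNIV
    by (intro eventually_ball_finite ballI) (auto intro!: sensitivity_real(1)[OF sens not_minf])
  moreover have "\<forall>\<^sub>F \<alpha> in at_right (0::real). 0 < \<alpha> \<and> \<alpha> < 1"
    by (rule eventually_at_rightI[of 0 1]) auto
  ultimately show ?thesis
  proof eventually_elim
    case (elim \<alpha>)
    then have "mix \<alpha> \<xi> \<eta> \<in> fin UNIV" by (simp add: fin_UNIV)
    moreover have "mix \<alpha> \<xi> \<eta> \<in> Xi A" using elim by (intro mix_in_Xi_on A \<xi>' \<eta>) auto
    ultimately show ?case using fin_iff[OF A] by blast
  qed
qed

text \<open>The integral is the one-sided derivative at 0 of the Lagrangian on the segment towards
  \<open>\<eta>\<close>, and the segment starts at a minimizer.\<close>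

lemma minimizer_integral_nonneg:
  assumes A: "A \<in> sets borel" and \<xi>: "\<xi> \<in> fin A" and \<eta>: "\<eta> \<in> Xi A"
    and min: "\<And>\<eta>. \<eta> \<in> fin A \<Longrightarrow> L \<xi> l \<le> L \<eta> l"
  shows "0 \<le> (\<integral>x. \<psi>L \<xi> l x \<partial>\<eta>)"
proof -
  have \<xi>': "\<xi> \<in> fin UNIV" using \<xi> fin_iff[OF A] by auto
  have \<eta>': "\<eta> \<in> Xi UNIV" using \<eta> Xi_iff_measure[OF A] by blast
  have lim: "((\<lambda>\<alpha>. (P i (mix \<alpha> \<xi> \<eta>) - P i \<xi>) / \<alpha>) \<longlongrightarrow> (\<integral>x. \<psi> i \<xi> x \<partial>\<eta>)) (at_right 0)"
    if "i \<in> insert 0 I" for i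
    using \<xi>' \<eta>' that fin_UNIV by (intro sensitivity_real(2) sens not_minf) auto
  have "((\<lambda>\<alpha>. (P 0 (mix \<alpha> \<xi> \<eta>) - P 0 \<xi>) / \<alpha> + (\<Sum>i\<in>I. l i * ((P i (mix \<alpha> \<xi> \<eta>) - P i \<xi>) / \<alpha>)))
      \<longlongrightarrow> (\<integral>x. \<psi>L \<xi> l x \<partial>\<eta>)) (at_right 0)"
    unfolding integral_\<psi>L(2)[OF \<xi>' \<eta>'] using lim by (intro tendsto_intros) auto
  moreover have "(P 0 (mix \<alpha> \<xi> \<eta>) - P 0 \<xi>) / \<alpha> + (\<Sum>i\<in>I. l i * ((P i (mix \<alpha> \<xi> \<eta>) - P i \<xi>) / \<alpha>))
      = (L (mix \<alpha> \<xi> \<eta>) l - L \<xi> l) / \<alpha>" for \<alpha>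
    by (simp add: L_def add_divide_distrib diff_divide_distrib sum_divide_distrib right_diff_distrib sum_subtractf)
  ultimately have "((\<lambda>\<alpha>. (L (mix \<alpha> \<xi> \<eta>) l - L \<xi> l) / \<alpha>) \<longlongrightarrow> (\<integral>x. \<psi>L \<xi> l x \<partial>\<eta>)) (at_right 0)"
    by simp
  moreover have "\<forall>\<^sub>F \<alpha> in at_right 0. 0 \<le> (L (mix \<alpha> \<xi> \<eta>) l - L \<xi> l) / \<alpha>"
    using eventually_mix_fin[OF A \<xi> \<eta>] eventually_at_right_less[of 0]
    by eventually_elim (use min in auto)
  ultimately show ?thesis by (rule tendsto_lowerbound) simp
qed

text \<open>First-order condition in the direction of the Dirac measure at \<open>x\<close>, where
  the integral is the value at \<open>x\<close>.\<close>

lemma minimizer_sensitivity_nonneg: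
  assumes A: "A \<in> sets borel" and \<xi>: "\<xi> \<in> fin A" and "x \<in> A"
    and min: "\<And>\<eta>. \<eta> \<in> fin A \<Longrightarrow> L \<xi> l \<le> L \<eta> l"
  shows "0 \<le> \<psi>L \<xi> l x"
proof -
  have r: "return borel x \<in> Xi A" by (rule return_in_Xi) fact+
  have "\<xi> \<in> fin UNIV" using \<xi> fin_iff[OF A] by auto
  then have "integrable (return borel x) (\<psi>L \<xi> l)" by (rule integral_\<psi>L) (rule return_in_Xi, auto)
  \<comment> \<open>Integrability against a single Dirac measure already contains Borel
    measurability.\<close>
  then have "\<psi>L \<xi> l \<in> borel_measurable borel" using borel_measurable_integrable by force
  then show ?thesis
    using minimizer_integral_nonneg[OF A \<xi> r min] by (simp add: integral_return)
qed

text \<open>Weak duality: \<Psi>_0(\<xi>) = L(\<xi>, l) by slackness, adding \<open>m\<close> stays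
  below L(\<eta>, l) by the subgradient inequality, and L(\<eta>, l) \<le> \<Psi>_0(\<eta>) by
  feasibility. The saddle point belongs to \<open>A\<close>, the competitor \<open>\<eta>\<close> to
  the whole space.\<close>

lemma feasible_lower_bound:
  assumes A: "A \<in> sets borel" and s: "saddle A \<xi> l" and \<eta>: "\<eta> \<in> feas UNIV"
    and m: "\<And>y. m \<le> \<psi>L \<xi> l y"
  shows "\<Psi> 0 \<xi> + ereal m \<le> \<Psi> 0 \<eta>"
proof (cases "\<Psi> 0 \<eta> < \<infinity>")
  case True
  note \<xi> = saddle_properties[OF A s]
  have \<eta>': "\<eta> \<in> fin UNIV" "\<eta> \<in> Xi UNIV" using feasible_fin[OF _ \<eta> True] \<eta> by (auto simp: Xi_feas_def)
  interpret prob_space \<eta> using \<eta>'(2) by (rule Xi_D)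
  have "m = (\<integral>x. m \<partial>\<eta>)" using prob_space by simp
  also have "\<dots> \<le> (\<integral>x. \<psi>L \<xi> l x \<partial>\<eta>)"
    using integral_\<psi>L(1)[OF \<xi>(1) \<eta>'(2)] m by (intro integral_mono) auto
  finally have "P 0 \<xi> + m \<le> P 0 \<eta>"
    using L_subgradient[OF \<xi>(1) \<eta>'(1) \<xi>(2)] feasible_L_le[OF \<eta> \<eta>'(1) \<xi>(2)] \<xi>(4) by linarith
  then show ?thesis using fin_real[OF \<xi>(1), of 0] fin_real[OF \<eta>'(1), of 0]
    by (metis ereal_less_eq(3) insertI1 plus_ereal.simps(1))
qed (simp add: not_less)

end

subsection \<open>Boundedness of the multipliers\<close>

text \<open>Bolzano-Weierstrass for vectors indexed by a finite set, refining the subsequence one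
  coordinate at a time.\<close>

lemma bounded_finite_index_subseq:
  fixes u :: "nat \<Rightarrow> 'j \<Rightarrow> real"
  assumes "finite J" "\<And>j. j \<in> J \<Longrightarrow> bounded (range (\<lambda>k. u k j))"
  shows "\<exists>r \<nu>. strict_mono (r :: nat \<Rightarrow> nat) \<and> (\<forall>j\<in>J. (\<lambda>k. u (r k) j) \<longlonglongrightarrow> \<nu> j)"
  using assms
proof (induction J)
  case empty
  show ?case using strict_mono_id by blast
next
  case (insert a J)
  then obtain r \<nu> where r: "strict_mono r" "\<forall>j\<in>J. (\<lambda>k. u (r k) j) \<longlonglongrightarrow> \<nu> j" by auto
  have "bounded (range (\<lambda>k. u (r k) a))"
    by (rule bounded_subset[OF insert.prems[of a]]) auto
  then obtain b q where q: "strict_mono q" "((\<lambda>k. u (r k) a) \<circ> q) \<longlonglongrightarrow> b"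
    using bounded_imp_convergent_subsequence by blast
  have "(\<lambda>k. u (r (q k)) j) \<longlonglongrightarrow> (\<nu>(a := b)) j" if "j \<in> insert a J" for j
    using q(2) LIMSEQ_subseq_LIMSEQ[OF bspec[OF r(2), of j] q(1)] that insert.hyps(2)
    by (cases "j = a") (auto simp: comp_def)
  moreover have "strict_mono (\<lambda>k. r (q k))" using r(1) q(1) by (simp add: strict_mono_def)
  ultimately show ?case by (intro exI[of _ "\<lambda>k. r (q k)"] exI[of _ "\<nu>(a := b)"]) auto
qed

text \<open>Otherwise the normalised vectors would cluster at a normal direction that witnesses one-sidedness.\<close>

lemma not_one_sided_imp_bounded:
  fixes u :: "nat \<Rightarrow> 'j \<Rightarrow> real"
  assumes J: "finite J" and not_one_sided: "\<not> one_sided J Z"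
    and below: "\<And>z. z \<in> Z \<Longrightarrow> \<exists>C. \<forall>k. C \<le> (\<Sum>j\<in>J. u k j * z j)"
  shows "\<exists>M. \<forall>k. \<forall>j\<in>J. \<bar>u k j\<bar> \<le> M"
proof -
  define N where "N k = (\<Sum>j\<in>J. \<bar>u k j\<bar>)" for k
  have u_N: "\<bar>u k j\<bar> \<le> N k" if "j \<in> J" for k j
    unfolding N_def using J that by (intro member_le_sum) auto
  have "\<exists>M. \<forall>k. N k \<le> M"
  proof (rule ccontr)
    assume "\<nexists>M. \<forall>k. N k \<le> M"
    then have "\<forall>n. \<exists>k. real (Suc n) < N k" by (meson not_le)
    \<comment> \<open>The indices \<open>r n\<close> may come in any order; the growth of
      \<open>N (r n)\<close> is what enters below.\<close>
    then obtain r where r: "\<And>n. real (Suc n) < N (r n)" by metis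
    have N_pos: "0 < N (r n)" for n using r[of n] by linarith
    define v where "v n j = u (r n) j / N (r n)" for n j
    have "bounded (range (\<lambda>n. v n j))" if "j \<in> J" for j
    proof (rule boundedI[of _ 1], clarify)
      show "norm (v n j) \<le> 1" for n using u_N[OF that, of "r n"] N_pos[of n] by (simp add: v_def)
    qed
    then have "\<exists>q \<nu>. strict_mono q \<and> (\<forall>j\<in>J. (\<lambda>n. v (q n) j) \<longlonglongrightarrow> \<nu> j)"
      by (intro bounded_finite_index_subseq J)
    then obtain q \<nu> where q: "strict_mono q" and \<nu>: "\<And>j. j \<in> J \<Longrightarrow> (\<lambda>n. v (q n) j) \<longlonglongrightarrow> \<nu> j"
      by blast
    \<comment> \<open>The normalised vectors have l1 norm 1, and this passes to the limit, so
      \<open>\<nu>\<close> is not zero.\<close>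
    have "(\<lambda>n. \<Sum>j\<in>J. \<bar>v (q n) j\<bar>) \<longlonglongrightarrow> (\<Sum>j\<in>J. \<bar>\<nu> j\<bar>)"
      using \<nu> by (intro tendsto_intros)
    moreover have "(\<Sum>j\<in>J. \<bar>v n j\<bar>) = 1" for n
      using N_pos[of n] by (simp add: v_def abs_divide N_def flip: sum_divide_distrib)
    ultimately have "(\<Sum>j\<in>J. \<bar>\<nu> j\<bar>) = 1" by (simp add: LIMSEQ_const_iff)
    then have "\<exists>j\<in>J. \<nu> j \<noteq> 0" by (metis abs_zero sum.neutral zero_neq_one)
    moreover have "0 \<le> (\<Sum>j\<in>J. \<nu> j * z j)" if z: "z \<in> Z" for z
    proof -
      obtain C where C: "\<And>k. C \<le> (\<Sum>j\<in>J. u k j * z j)" using below[OF z] by blast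
      have lim: "(\<lambda>n. \<Sum>j\<in>J. v (q n) j * z j) \<longlonglongrightarrow> (\<Sum>j\<in>J. \<nu> j * z j)"
        using \<nu> by (intro tendsto_intros)
      have null: "(\<lambda>n. - \<bar>C\<bar> * inverse (real (Suc n))) \<longlonglongrightarrow> - \<bar>C\<bar> * 0"
        by (intro tendsto_mult_left LIMSEQ_inverse_real_of_nat)
      have "- \<bar>C\<bar> * inverse (real (Suc n)) \<le> (\<Sum>j\<in>J. v (q n) j * z j)" for n
      proof -
        \<comment> \<open>Passing to the subsequence keeps the growth rate: N (r (q n)) > q n + 1
          \<ge> n + 1, so the lower bound \<open>C\<close> divided by the norm vanishes.\<close>
        have "n \<le> q n" using q by (rule seq_suble)
        then have n: "real (Suc n) \<le> N (r (q n))" using r[of "q n"] by linarith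
        have "\<bar>C\<bar> / N (r (q n)) \<le> \<bar>C\<bar> / real (Suc n)"
          using n N_pos by (intro divide_left_mono) auto
        then have "- \<bar>C\<bar> * inverse (real (Suc n)) \<le> - \<bar>C\<bar> / N (r (q n))"
          by (simp add: divide_inverse)
        also have "\<dots> \<le> (\<Sum>j\<in>J. u (r (q n)) j * z j) / N (r (q n))"
          using C[of "r (q n)"] N_pos by (intro divide_right_mono) (auto intro: less_imp_le)
        also have "\<dots> = (\<Sum>j\<in>J. v (q n) j * z j)" by (simp add: v_def sum_divide_distrib)
        finally show ?thesis .
      qed
      then have "- \<bar>C\<bar> * 0 \<le> (\<Sum>j\<in>J. \<nu> j * z j)" by (intro LIMSEQ_le[OF null lim]) blast
      then show ?thesis by simp
    qed
    ultimately have "one_sided J Z" unfolding one_sided_def by blast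
    with not_one_sided show False by simp
  qed
  then obtain M where "\<And>k. N k \<le> M" by blast
  then have "\<bar>u k j\<bar> \<le> M" if "j \<in> J" for k j by (rule order_trans[OF u_N[OF that]])
  then show ?thesis by blast
qed

text \<open>At the Slater point every inequality term of the Lagrangian is nonpositive and the
  equality terms vanish, so the lower bound \<open>c\<close> limits each inequality multiplier. A
  short move from the Slater point towards any \<open>\<eta>\<close> then bounds the equality part
  below in direction \<open>\<eta>\<close>, and lack of one-sidedness turns these bounds into a
  bound on the multipliers.\<close>

lemma (in measure_program) multipliers_bounded:
  fixes \<xi> :: "nat \<Rightarrow> 'a measure" and l :: "nat \<Rightarrow> 'i \<Rightarrow> real"
  assumes A: "A \<in> sets borel" and \<eta>0: "\<eta>0 \<in> fin A"
    and slater: "\<And>i. i \<in> Iineq \<Longrightarrow> P i \<eta>0 < 0" "\<And>i. i \<in> Ieq \<Longrightarrow> P i \<eta>0 = 0"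
    and not_one_sided: "\<not> one_sided Ieq ((\<lambda>\<eta>. \<lambda>i\<in>Ieq. P i \<eta>) ` Xi A)"
    and l: "\<And>k. l k \<in> mult" and below: "\<And>k \<eta>. \<eta> \<in> fin A \<Longrightarrow> c \<le> L \<eta> (l k)"
  shows "\<exists>M. \<forall>k. \<forall>i\<in>I. \<bar>l k i\<bar> \<le> M"
proof -
  have L_split: "L \<eta> m = P 0 \<eta> + (\<Sum>i\<in>Iineq. m i * P i \<eta>) + (\<Sum>i\<in>Ieq. m i * P i \<eta>)" for \<eta> m
    unfolding L_def using index_sets by (simp add: sum.union_disjoint)
  have l_nonneg: "0 \<le> l k i" if "i \<in> Iineq" for k i using l[of k] that by (simp add: mult_iff)
  \<comment> \<open>The sum of the individual bounds serves as one constant for all inequality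
    indices.\<close>
  define M1 where "M1 = (\<Sum>i\<in>Iineq. \<bar>P 0 \<eta>0 - c\<bar> / - P i \<eta>0)"
  have M1: "l k i \<le> M1" if i: "i \<in> Iineq" for k i
  proof -
    have "(\<Sum>j\<in>Iineq. l k j * P j \<eta>0) \<le> l k i * P i \<eta>0"
    proof -
      have "(\<Sum>j\<in>Iineq - {i}. l k j * P j \<eta>0) \<le> 0"
        using less_imp_le[OF slater(1)] l_nonneg by (intro sum_nonpos mult_nonneg_nonpos) blast+
      then show ?thesis using index_sets(1) i by (simp add: sum.remove)
    qed
    then have "l k i * - P i \<eta>0 \<le> \<bar>P 0 \<eta>0 - c\<bar>"
      using below[OF \<eta>0, of k] slater(2) by (simp add: L_split)
    then have "l k i \<le> \<bar>P 0 \<eta>0 - c\<bar> / - P i \<eta>0"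
      using slater(1)[OF i] by (simp only: pos_le_divide_eq neg_0_less_iff_less)
    also have "\<dots> \<le> M1"
      unfolding M1_def using index_sets(1) i slater(1)
      by (intro member_le_sum) (auto intro!: divide_nonneg_pos simp del: divide_minus_right)
    finally show ?thesis .
  qed
  have "\<exists>C. \<forall>k. C \<le> (\<Sum>i\<in>Ieq. l k i * (\<lambda>i\<in>Ieq. P i \<eta>) i)" if \<eta>: "\<eta> \<in> Xi A" for \<eta>
  proof -
    have Xi: "\<eta> \<in> Xi UNIV" "\<eta>0 \<in> Xi UNIV" using \<eta> \<eta>0 Xi_iff_measure[OF A] by (auto simp: Xi_fin_def)
    have "\<forall>\<^sub>F \<alpha> in at_right 0. mix \<alpha> \<eta>0 \<eta> \<in> fin A \<and> 0 < \<alpha> \<and> \<alpha> < 1"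
      by (intro eventually_conj eventually_mix_fin[OF A \<eta>0 \<eta>])
         (auto intro: eventually_at_rightI[of 0 1])
    then obtain \<alpha> where \<alpha>: "mix \<alpha> \<eta>0 \<eta> \<in> fin A" "0 < \<alpha>" "\<alpha> < 1"
      using eventually_happens'[of "at_right (0::real)"] by auto
    define \<zeta> where "\<zeta> = mix \<alpha> \<eta>0 \<eta>"
    \<comment> \<open>The Slater point has zero equality values, so by affinity only the share of
      \<open>\<eta>\<close> remains.\<close>
    have eq: "P i \<zeta> = \<alpha> * P i \<eta>" if "i \<in> Ieq" for i
      unfolding \<zeta>_def using affine_mix_real[OF eq_affine[OF that] eq_real[OF that] Xi(2,1), of \<alpha>] \<alpha> slater(2)[OF that]
      by simp
    \<comment> \<open>\<open>\<alpha>\<close> and \<open>\<zeta>\<close> depend on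
      \<open>\<eta>\<close> but not on \<open>k\<close>, which makes the bound uniform in
      \<open>k\<close>.\<close>
    have "(c - P 0 \<zeta> - (\<Sum>i\<in>Iineq. M1 * \<bar>P i \<zeta>\<bar>)) / \<alpha> \<le> (\<Sum>i\<in>Ieq. l k i * P i \<eta>)" for k
    proof -
      have "(\<Sum>i\<in>Iineq. l k i * P i \<zeta>) \<le> (\<Sum>i\<in>Iineq. M1 * \<bar>P i \<zeta>\<bar>)"
      proof (rule sum_mono)
        fix i assume i: "i \<in> Iineq"
        have "l k i * P i \<zeta> \<le> l k i * \<bar>P i \<zeta>\<bar>" by (rule mult_left_mono[OF abs_ge_self l_nonneg[OF i]])
        also have "\<dots> \<le> M1 * \<bar>P i \<zeta>\<bar>" by (rule mult_right_mono[OF M1[OF i] abs_ge_zero])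
        finally show "l k i * P i \<zeta> \<le> M1 * \<bar>P i \<zeta>\<bar>" .
      qed
      moreover have "c \<le> L \<zeta> (l k)" using below \<alpha>(1) by (simp add: \<zeta>_def)
      moreover have "(\<Sum>i\<in>Ieq. l k i * P i \<zeta>) = \<alpha> * (\<Sum>i\<in>Ieq. l k i * P i \<eta>)"
        unfolding sum_distrib_left by (intro sum.cong) (auto simp: eq)
      ultimately have "c - P 0 \<zeta> - (\<Sum>i\<in>Iineq. M1 * \<bar>P i \<zeta>\<bar>) \<le> \<alpha> * (\<Sum>i\<in>Ieq. l k i * P i \<eta>)"
        unfolding L_split by linarith
      then show ?thesis using \<alpha>(2) by (simp add: pos_divide_le_eq mult.commute)
    qed
    then show ?thesis by auto
  qed
  then have "\<exists>M. \<forall>k. \<forall>i\<in>Ieq. \<bar>l k i\<bar> \<le> M"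
    by (intro not_one_sided_imp_bounded[OF index_sets(2) not_one_sided]) blast
  then obtain M2 where M2: "\<And>k i. i \<in> Ieq \<Longrightarrow> \<bar>l k i\<bar> \<le> M2" by blast
  have "\<bar>l k i\<bar> \<le> max M1 M2" if "i \<in> I" for k i
    using that M1[of i k] M2[of i k] l_nonneg[of i k] by (cases "i \<in> Ieq") auto
  then show ?thesis by blast
qed

subsection \<open>Infinite runs of the algorithm\<close>

lemma limitin_subseq_imp_accumulation_point:
  assumes "strict_mono r" "limitin T (\<lambda>k. s (r k)) a sequentially"
  shows "accumulation_point T s a"
proof -
  have "\<exists>\<^sub>\<infinity>k. s k \<in> U" if U: "openin T U" "a \<in> U" for U
    unfolding INFM_nat_le
  proof
    fix m
    obtain N where N: "\<And>k. k \<ge> N \<Longrightarrow> s (r k) \<in> U"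
      using assms(2) U by (auto simp: limitin_sequentially)
    have "m \<le> r (max N m)" using seq_suble[OF assms(1), of "max N m"] by linarith
    then show "\<exists>n\<ge>m. s n \<in> U" using N[of "max N m"] by auto
  qed
  then show ?thesis using assms(2) by (auto simp: accumulation_point_def limitin_def)
qed

text \<open>An infinitely often visited neighbourhood meets every eventual property. Semicontinuity
  and continuity are thus applied through open sets, with no subsequence converging to the
  accumulation point.\<close>

lemma accumulation_point_frequently_eventually:
  assumes "accumulation_point T s a" "openin T U" "a \<in> U" "\<forall>\<^sub>F k in sequentially. Q (s k)"
  obtains k where "s k \<in> U" "Q (s k)"
proof -
  obtain N where N: "\<And>k. k \<ge> N \<Longrightarrow> Q (s k)" using assms(4) by (auto simp: eventually_sequentially)
  have "\<exists>\<^sub>\<infinity>k. s k \<in> U" using assms(1-3) by (simp add: accumulation_point_def)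
  then obtain k where "k \<ge> N" "s k \<in> U" by (auto simp: INFM_nat_le)
  with N that show thesis by blast
qed

lemma lower_semicontinuous_accumulation_le:
  assumes lsc: "lower_semicontinuous_map T f" and acc: "accumulation_point T s a"
    and le: "\<forall>\<^sub>F k in sequentially. f (s k) \<le> c"
  shows "f a \<le> c"
proof (rule ccontr)
  assume "\<not> f a \<le> c"
  then have "openin T {x \<in> topspace T. c < f x}" "a \<in> {x \<in> topspace T. c < f x}"
    using lsc acc by (auto simp: lower_semicontinuous_map_def accumulation_point_def)
  then obtain k where "s k \<in> {x \<in> topspace T. c < f x}" "f (s k) \<le> c"
    by (rule accumulation_point_frequently_eventually[OF acc _ _ le])
  then show False by (auto dest: leD)
qed

lemma continuous_accumulation_eq:
  fixes f :: "'b \<Rightarrow> 'c::t1_space"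
  assumes cont: "continuous_map T euclidean f" and acc: "accumulation_point T s a"
    and eq: "\<And>k. f (s k) = c"
  shows "f a = c"
proof (rule ccontr)
  assume "f a \<noteq> c"
  then have "a \<in> {x \<in> topspace T. f x \<in> - {c}}" using acc by (simp add: accumulation_point_def)
  moreover have "openin T {x \<in> topspace T. f x \<in> - {c}}"
    by (rule openin_continuous_map_preimage[OF cont]) (simp add: open_openin[symmetric] open_Compl)
  ultimately obtain k where "s k \<in> {x \<in> topspace T. f x \<in> - {c}}"
    using accumulation_point_frequently_eventually[OF acc, where Q = "\<lambda>_. True"] by auto
  then show False using eq by simp
qed

text \<open>Continuity is joint, but only over the domain; the limit measure has to be known to have
  a finite value beforehand.\<close>

lemma continuous_sensitivity_limit:
  fixes \<xi> :: "'b \<Rightarrow> 'a::metric_space measure"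
  assumes "continuous_sensitivity \<Psi> \<psi>" "limitin weak_topology \<xi> \<eta> F" "\<And>k. \<xi> k \<in> fin_dom \<Psi>"
    "\<eta> \<in> fin_dom \<Psi>" "(u \<longlongrightarrow> y) F"
  shows "((\<lambda>k. \<psi> (\<xi> k) (u k)) \<longlongrightarrow> \<psi> \<eta> y) F"
proof -
  have "limitin (prod_topology (subtopology weak_topology (fin_dom \<Psi>)) euclidean)
      (\<lambda>k. (\<xi> k, u k)) (\<eta>, y) F"
    using assms(2-5) by (auto simp: limitin_pairwise limitin_subtopology comp_def)
  from continuous_map_limit[OF assms(1)[unfolded continuous_sensitivity_def] this]
  show ?thesis by (simp add: comp_def)
qed

section \<open>Convergence of a non-terminating run\<close>

locale infinite_run = measure_program \<Psi> \<psi> Iineq Ieq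
  for \<Psi> :: "'i::zero \<Rightarrow> 'a::metric_space measure \<Rightarrow> ereal"
    and \<psi> :: "'i \<Rightarrow> 'a measure \<Rightarrow> 'a \<Rightarrow> real" and Iineq Ieq +
  fixes Xs :: "nat \<Rightarrow> 'a set" and \<xi> :: "nat \<Rightarrow> 'a measure" and l :: "nat \<Rightarrow> 'i \<Rightarrow> real"
    and x :: "nat \<Rightarrow> 'a" and \<delta> :: "nat \<Rightarrow> real" and \<eta>0 :: "'a measure"
  assumes compact: "compact (UNIV :: 'a set)"
    and lsc: "\<And>i. i \<in> insert 0 Iineq \<Longrightarrow> lower_semicontinuous_map weak_topology (\<Psi> i)"
    and eq_continuous: "\<And>i. i \<in> Ieq \<Longrightarrow> continuous_map weak_topology euclidean (\<Psi> i)"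
    and sensitivity_form: "\<And>i. i \<in> insert 0 I \<Longrightarrow> continuous_sensitivity (\<Psi> i) (\<psi> i) \<or>
      (\<exists>g :: 'a \<Rightarrow> real. bounded (range g) \<and> (\<forall>\<eta>\<in>fin_dom (\<Psi> i). \<forall>y. \<psi> i \<eta> y = g y - P i \<eta>))"
    and Xs_borel: "\<And>k. Xs k \<in> sets borel"
    and Xs_Suc: "\<And>k. Xs (Suc k) = Xs k \<union> {x k}"
    and saddle: "\<And>k. saddle (Xs k) (\<xi> k) (l k)"
    and best: "\<And>k y. \<psi>L (\<xi> k) (l k) (x k) - \<delta> k \<le> \<psi>L (\<xi> k) (l k) y"
    and \<delta>: "\<delta> \<longlonglongrightarrow> 0"
    and \<eta>0: "\<eta>0 \<in> fin (Xs 0)"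
    and slater: "\<And>i. i \<in> Iineq \<Longrightarrow> P i \<eta>0 < 0" "\<And>i. i \<in> Ieq \<Longrightarrow> P i \<eta>0 = 0"
    and not_one_sided: "\<not> one_sided Ieq ((\<lambda>\<eta>. \<lambda>i\<in>Ieq. P i \<eta>) ` Xi (Xs 0))"
begin

lemmas run = saddle_properties[OF Xs_borel saddle]

lemma Xs_mono: "j \<le> k \<Longrightarrow> Xs j \<subseteq> Xs k"
  by (rule lift_Suc_mono_le) (auto simp: Xs_Suc)

lemma fin_Xs_mono: "j \<le> k \<Longrightarrow> fin (Xs j) \<subseteq> fin (Xs k)"
  using Xi_mono[OF Xs_borel Xs_borel Xs_mono, of j k] fin_iff[OF Xs_borel] by blast

lemma \<xi>_fin: "\<xi> k \<in> fin (Xs k)"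
  using saddle by (auto simp: saddle_point_def)

lemma \<xi>_Xi: "\<xi> k \<in> Xi UNIV"
  using run(1)[of k] by (simp add: Xi_fin_def)

lemma \<Psi>0_real: "ereal (P 0 (\<xi> k)) = \<Psi> 0 (\<xi> k)"
  using fin_real[OF run(1), of 0 k] by simp

text \<open>\<open>\<xi> k\<close> still competes on the enlarged discretization. Being feasible, it
  has a Lagrangian value of at most its objective value for the new multiplier.\<close>

lemma \<Psi>0_decreasing: "decseq (\<lambda>k. \<Psi> 0 (\<xi> k))"
proof (rule decseq_SucI)
  fix k
  have "\<xi> k \<in> fin (Xs (Suc k))" using \<xi>_fin[of k] fin_Xs_mono[of k "Suc k"] by auto
  then have "P 0 (\<xi> (Suc k)) \<le> L (\<xi> k) (l (Suc k))" using run(5)[of "\<xi> k" "Suc k"] run(4)[of "Suc k"] by simp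
  also have "\<dots> \<le> P 0 (\<xi> k)" by (rule feasible_L_le[OF run(3) run(1) run(2)])
  finally show "\<Psi> 0 (\<xi> (Suc k)) \<le> \<Psi> 0 (\<xi> k)" by (metis \<Psi>0_real ereal_less_eq(3))
qed

text \<open>Monotonicity bounds all later values by \<Psi>_0(\<xi> k), and semicontinuity passes
  this on. The finite value obtained from k = 0 puts the limit where sensitivities are defined and
  continuous.\<close>

lemma accumulation_feasible:
  assumes acc: "accumulation_point weak_topology \<xi> \<xi>s"
  shows "\<xi>s \<in> feas UNIV" "\<Psi> 0 \<xi>s \<le> \<Psi> 0 (\<xi> k)" "\<xi>s \<in> fin UNIV"
proof -
  have Xi: "\<xi>s \<in> Xi UNIV" using acc by (simp add: accumulation_point_def)
  have "\<Psi> i \<xi>s \<le> 0" if "i \<in> Iineq" for i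
    using run(3) that lsc by (intro lower_semicontinuous_accumulation_le[OF _ acc]) (auto simp: Xi_feas_def)
  moreover have "\<Psi> i \<xi>s = 0" if "i \<in> Ieq" for i
    using run(3) that by (intro continuous_accumulation_eq[OF eq_continuous acc]) (auto simp: Xi_feas_def)
  ultimately show feas: "\<xi>s \<in> feas UNIV" using Xi by (simp add: Xi_feas_def)
  show le: "\<Psi> 0 \<xi>s \<le> \<Psi> 0 (\<xi> k)" for k
  proof (rule lower_semicontinuous_accumulation_le[OF lsc acc])
    show "\<forall>\<^sub>F j in sequentially. \<Psi> 0 (\<xi> j) \<le> \<Psi> 0 (\<xi> k)"
      using \<Psi>0_decreasing by (auto simp: eventually_sequentially decseq_def)
  qed simp
  show "\<xi>s \<in> fin UNIV"
  proof (rule feasible_fin[OF _ feas])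
    have "\<Psi> 0 (\<xi> 0) < \<infinity>" using run(1)[of 0] by (simp add: Xi_fin_def fin_dom_def)
    with le[of 0] show "\<Psi> 0 \<xi>s < \<infinity>" by (rule le_less_trans)
  qed simp
qed

text \<open>The lower bound \<open>c\<close> for \<open>multipliers_bounded\<close> is the objective
  value at an accumulation point: it lies below every \<open>P 0 (\<xi> k)\<close>, which is the
  minimum of the Lagrangian on \<open>Xs k\<close> and hence below its values on
  \<open>Xs 0\<close>.\<close>

lemma l_bounded:
  obtains M where "0 \<le> M" "\<And>k i. i \<in> I \<Longrightarrow> \<bar>l k i\<bar> \<le> M"
proof -
  obtain r \<xi>s where r: "strict_mono r" "limitin weak_topology (\<lambda>k. \<xi> (r k)) \<xi>s sequentially"
    by (rule weak_sequentially_compact[OF compact \<xi>_Xi])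
  have acc: "accumulation_point weak_topology \<xi> \<xi>s" by (rule limitin_subseq_imp_accumulation_point[OF r])
  have "P 0 \<xi>s \<le> L \<eta> (l k)" if "\<eta> \<in> fin (Xs 0)" for \<eta> k
  proof -
    have "ereal (P 0 \<xi>s) \<le> ereal (P 0 (\<xi> k))"
      using accumulation_feasible(2)[OF acc, of k] fin_real[OF accumulation_feasible(3)[OF acc], of 0]
      unfolding \<Psi>0_real by simp
    also have "P 0 (\<xi> k) \<le> L \<eta> (l k)"
      using run(4)[of k] run(5)[of \<eta> k] that fin_Xs_mono[of 0 k] by auto
    finally show ?thesis by simp
  qed
  then have "\<exists>M. \<forall>k. \<forall>i\<in>I. \<bar>l k i\<bar> \<le> M"
    by (intro multipliers_bounded[OF Xs_borel \<eta>0 slater not_one_sided run(2)]) assumption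
  then obtain M where M: "\<And>k i. i \<in> I \<Longrightarrow> \<bar>l k i\<bar> \<le> M" by blast
  have "\<bar>l k i\<bar> \<le> max M 0" if "i \<in> I" for k i using M[OF that, of k] by simp
  then show thesis by (intro that[of "max M 0"]) auto
qed

text \<open>In a difference of two values of \<open>g y - P i \<eta>\<close> at the same \<open>\<eta>\<close> the second term cancels, so it is
  enough that the bounded values \<open>g (x k)\<close> converge along a subsequence; \<open>g\<close> may be discontinuous.\<close>

lemma sensitivity_difference_limit:
  obtains r c where "strict_mono r"
    "\<And>i j. i \<in> insert 0 I \<Longrightarrow>
      (\<lambda>n. \<psi> i (\<xi> (r n)) (x (r n)) - \<psi> i (\<xi> (r n)) (x (r j))) \<longlonglongrightarrow> c i j"
    "\<And>i. i \<in> insert 0 I \<Longrightarrow> c i \<longlonglongrightarrow> 0"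
proof -
  \<comment> \<open>The dummy g = 0 in the continuous case lets one subsequence extraction treat all
    indices alike.\<close>
  have "\<exists>g :: 'a \<Rightarrow> real. bounded (range g) \<and> (continuous_sensitivity (\<Psi> i) (\<psi> i) \<or>
      (\<forall>\<eta>\<in>fin_dom (\<Psi> i). \<forall>y. \<psi> i \<eta> y = g y - P i \<eta>))" if "i \<in> insert 0 I" for i
    using sensitivity_form[OF that]
  proof
    assume "continuous_sensitivity (\<Psi> i) (\<psi> i)"
    then show ?thesis by (intro exI[of _ "\<lambda>_. 0"]) auto
  qed blast
  then have "\<forall>i\<in>insert 0 I. \<exists>g :: 'a \<Rightarrow> real. bounded (range g) \<and> (continuous_sensitivity (\<Psi> i) (\<psi> i) \<or>
      (\<forall>\<eta>\<in>fin_dom (\<Psi> i). \<forall>y. \<psi> i \<eta> y = g y - P i \<eta>))" by blast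
  from bchoice[OF this] obtain g :: "'i \<Rightarrow> 'a \<Rightarrow> real" where g_bdd: "\<And>i. i \<in> insert 0 I \<Longrightarrow> bounded (range (g i))"
    and g: "\<And>i. i \<in> insert 0 I \<Longrightarrow> continuous_sensitivity (\<Psi> i) (\<psi> i) \<or>
      (\<forall>\<eta>\<in>fin_dom (\<Psi> i). \<forall>y. \<psi> i \<eta> y = g i y - P i \<eta>)"
    by blast
  obtain r1 \<xi>s where r1: "strict_mono r1" "limitin weak_topology (\<lambda>k. \<xi> (r1 k)) \<xi>s sequentially"
    by (rule weak_sequentially_compact[OF compact \<xi>_Xi])
  have "\<xi>s \<in> fin UNIV"
    by (rule accumulation_feasible[OF limitin_subseq_imp_accumulation_point[OF r1]])
  then have \<xi>s: "\<xi>s \<in> fin_dom (\<Psi> i)" if "i \<in> insert 0 I" for i using that fin_UNIV by blast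
  have \<xi>_dom: "\<xi> k \<in> fin_dom (\<Psi> i)" if "i \<in> insert 0 I" for i k using run(1)[of k] that fin_UNIV by blast
  obtain y r2 where r2: "strict_mono r2" "((\<lambda>k. x (r1 k)) \<circ> r2) \<longlonglongrightarrow> y"
    by (rule seq_compactE[OF compact_imp_seq_compact[OF compact], of "\<lambda>k. x (r1 k)"]) auto
  have "bounded (range (\<lambda>k. g i (x (r1 (r2 k)))))" if "i \<in> insert 0 I" for i
    by (rule bounded_subset[OF g_bdd[OF that]]) auto
  then have "\<exists>r3 \<gamma>. strict_mono r3 \<and> (\<forall>i\<in>insert 0 I. (\<lambda>k. g i (x (r1 (r2 (r3 k))))) \<longlonglongrightarrow> \<gamma> i)"
    using finite_I by (intro bounded_finite_index_subseq[where u = "\<lambda>k i. g i (x (r1 (r2 k)))"]) simp_all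
  then obtain r3 \<gamma> where r3: "strict_mono r3"
    and \<gamma>: "\<And>i. i \<in> insert 0 I \<Longrightarrow> (\<lambda>k. g i (x (r1 (r2 (r3 k))))) \<longlonglongrightarrow> \<gamma> i"
    by blast
  define r where "r k = r1 (r2 (r3 k))" for k
  have r: "strict_mono r" using r1(1) r2(1) r3 by (simp add: r_def strict_mono_def)
  have x_lim: "(\<lambda>k. x (r k)) \<longlonglongrightarrow> y"
    using LIMSEQ_subseq_LIMSEQ[OF r2(2) r3] by (simp add: comp_def r_def)
  have \<xi>_lim: "limitin weak_topology (\<lambda>k. \<xi> (r k)) \<xi>s sequentially"
    using limitin_subsequence[OF strict_mono_o[OF r2(1) r3] r1(2)] by (simp add: comp_def r_def)
  \<comment> \<open>The limit in \<open>n\<close> at fixed \<open>j\<close>. It tends to 0 in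
    \<open>j\<close> because \<open>x (r j)\<close> tends to \<open>y\<close> in the continuous case
    and the \<open>g\<close>-values tend to \<open>\<gamma> i\<close> in the other.\<close>
  define c where "c i j = (if continuous_sensitivity (\<Psi> i) (\<psi> i) then \<psi> i \<xi>s y - \<psi> i \<xi>s (x (r j))
    else \<gamma> i - g i (x (r j)))" for i j
  show thesis
  proof
    show "strict_mono r" by fact
    fix i assume i: "i \<in> insert 0 I"
    show "(\<lambda>n. \<psi> i (\<xi> (r n)) (x (r n)) - \<psi> i (\<xi> (r n)) (x (r j))) \<longlonglongrightarrow> c i j" for j
    proof (cases "continuous_sensitivity (\<Psi> i) (\<psi> i)")
      case True
      then show ?thesis unfolding c_def
        by (simp, intro tendsto_diff continuous_sensitivity_limit[OF True \<xi>_lim \<xi>_dom[OF i] \<xi>s[OF i]] x_lim tendsto_const)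
    next
      case False
      then show ?thesis using g[OF i] \<xi>_dom[OF i] tendsto_diff[OF \<gamma>[OF i] tendsto_const]
        by (simp add: c_def r_def)
    qed
    show "c i \<longlonglongrightarrow> 0"
    proof (cases "continuous_sensitivity (\<Psi> i) (\<psi> i)")
      case True
      have "limitin weak_topology (\<lambda>_. \<xi>s) \<xi>s sequentially"
        using \<xi>s[OF i] by (simp add: limitin_const_iff limitin_def fin_dom_def)
      from continuous_sensitivity_limit[OF True this \<xi>s[OF i] \<xi>s[OF i] x_lim]
      have "(\<lambda>j. \<psi> i \<xi>s y - \<psi> i \<xi>s (x (r j))) \<longlonglongrightarrow> \<psi> i \<xi>s y - \<psi> i \<xi>s y"
        by (intro tendsto_intros)
      then show ?thesis using True by (simp add: c_def[abs_def])
    next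
      case False
      have "(\<lambda>j. \<gamma> i - g i (x (r j))) \<longlonglongrightarrow> \<gamma> i - \<gamma> i"
        using \<gamma>[OF i] unfolding r_def by (intro tendsto_intros)
      then show ?thesis using False by (simp add: c_def[abs_def])
    qed
  qed
qed

text \<open>The earlier points \<open>x j\<close> belong to the current discretization, on which \<open>\<xi> k\<close> minimises the
  Lagrangian; the new point \<open>x k\<close> cannot do much better than an earlier point close to it.\<close>

lemma sensitivity_frequently_large:
  assumes e: "e > 0"
  shows "\<exists>\<^sub>\<infinity>k. - e < \<psi>L (\<xi> k) (l k) (x k)"
proof -
  obtain r c where r: "strict_mono r" and
    D: "\<And>i j. i \<in> insert 0 I \<Longrightarrow>
      (\<lambda>n. \<psi> i (\<xi> (r n)) (x (r n)) - \<psi> i (\<xi> (r n)) (x (r j))) \<longlonglongrightarrow> c i j" and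
    c: "\<And>i. i \<in> insert 0 I \<Longrightarrow> c i \<longlonglongrightarrow> 0"
    by (rule sensitivity_difference_limit) blast
  obtain M where M: "0 \<le> M" "\<And>k i. i \<in> I \<Longrightarrow> \<bar>l k i\<bar> \<le> M" by (rule l_bounded) blast
  define d where "d i j n = \<psi> i (\<xi> (r n)) (x (r n)) - \<psi> i (\<xi> (r n)) (x (r j))" for i j n
  \<comment> \<open>Bounds the change of the Lagrangian sensitivity between the two points, whatever
    the multipliers within the bound \<open>M\<close>.\<close>
  define E where "E j n = \<bar>d 0 j n\<bar> + (\<Sum>i\<in>I. M * \<bar>d i j n\<bar>)" for j n
  define E' where "E' j = \<bar>c 0 j\<bar> + (\<Sum>i\<in>I. M * \<bar>c i j\<bar>)" for j
  have "E' \<longlonglongrightarrow> \<bar>0\<bar> + (\<Sum>i\<in>I. M * \<bar>0\<bar>)"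
    unfolding E'_def using c by (intro tendsto_intros) auto
  then have "\<forall>\<^sub>F j in sequentially. E' j < e" using e by (intro order_tendstoD(2)) auto
  \<comment> \<open>The earlier point is fixed first through the iterated limit; how late
    \<open>n\<close> must be depends on it.\<close>
  then obtain j where j: "E' j < e" by (auto simp: eventually_sequentially)
  have "(\<lambda>n. E j n) \<longlonglongrightarrow> E' j"
    unfolding E_def E'_def d_def using D by (intro tendsto_intros) auto
  then have "\<forall>\<^sub>F n in sequentially. E j n < e" using j by (rule order_tendstoD(2))
  then obtain N where N: "\<And>n. n \<ge> N \<Longrightarrow> E j n < e" by (auto simp: eventually_sequentially)
  have large: "- e < \<psi>L (\<xi> (r n)) (l (r n)) (x (r n))" if n: "n \<ge> N" "j < n" for n
  proof -
    \<comment> \<open>The point \<open>x (r j)\<close> enters the discretization only at stage r j +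
      1.\<close>
    have "Suc (r j) \<le> r n" using r n(2) by (simp add: strict_mono_def Suc_le_eq)
    then have "x (r j) \<in> Xs (r n)" using Xs_mono[of "Suc (r j)" "r n"] Xs_Suc by blast
    then have "0 \<le> \<psi>L (\<xi> (r n)) (l (r n)) (x (r j))"
      by (intro minimizer_sensitivity_nonneg[OF Xs_borel \<xi>_fin] run(5)) auto
    also have "\<dots> = \<psi>L (\<xi> (r n)) (l (r n)) (x (r n)) - (d 0 j n + (\<Sum>i\<in>I. l (r n) i * d i j n))"
      by (simp add: Lagrangian_sensitivity_def d_def sum_subtractf right_diff_distrib)
    finally have "0 \<le> \<psi>L (\<xi> (r n)) (l (r n)) (x (r n)) - (d 0 j n + (\<Sum>i\<in>I. l (r n) i * d i j n))" .
    moreover have "- (\<Sum>i\<in>I. M * \<bar>d i j n\<bar>) \<le> (\<Sum>i\<in>I. l (r n) i * d i j n)"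
      unfolding sum_negf[symmetric]
    proof (rule sum_mono)
      fix i assume "i \<in> I"
      then have "\<bar>l (r n) i\<bar> * \<bar>d i j n\<bar> \<le> M * \<bar>d i j n\<bar>" using M by (intro mult_right_mono) auto
      then show "- (M * \<bar>d i j n\<bar>) \<le> l (r n) i * d i j n" using abs_ge_minus_self[of "l (r n) i * d i j n"] unfolding abs_mult by linarith
    qed
    ultimately show ?thesis using N[OF n(1)] unfolding E_def by linarith
  qed
  show ?thesis unfolding INFM_nat_le
  proof
    fix m
    let ?n = "max m (max N (Suc j))"
    have "m \<le> r ?n" using seq_suble[OF r, of ?n] by linarith
    moreover have "- e < \<psi>L (\<xi> (r ?n)) (l (r ?n)) (x (r ?n))" by (rule large) auto
    ultimately show "\<exists>k\<ge>m. - e < \<psi>L (\<xi> k) (l k) (x k)" by blast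
  qed
qed

text \<open>Half of \<open>e\<close> pays for the tolerance and half for the sensitivity at
  \<open>x k\<close>. The tolerance is eventually small and the sensitivity infinitely often large,
  so some index satisfies both.\<close>

lemma nearly_optimal:
  assumes e: "e > 0"
  obtains k where "\<And>\<eta>. \<eta> \<in> feas UNIV \<Longrightarrow> \<Psi> 0 (\<xi> k) \<le> \<Psi> 0 \<eta> + ereal e"
proof -
  have "\<forall>\<^sub>F k in sequentially. \<delta> k < e / 2" using \<delta> e by (intro order_tendstoD(2)) auto
  then obtain N where N: "\<And>k. k \<ge> N \<Longrightarrow> \<delta> k < e / 2" by (auto simp: eventually_sequentially)
  have "\<exists>\<^sub>\<infinity>k. - (e / 2) < \<psi>L (\<xi> k) (l k) (x k)" using e by (intro sensitivity_frequently_large) auto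
  then obtain k where k: "k \<ge> N" "- (e / 2) < \<psi>L (\<xi> k) (l k) (x k)" by (auto simp: INFM_nat_le)
  have "- e \<le> \<psi>L (\<xi> k) (l k) y" for y using best[of k y] N[OF k(1)] k(2) by linarith
  then have "\<Psi> 0 (\<xi> k) + ereal (- e) \<le> \<Psi> 0 \<eta>" if "\<eta> \<in> feas UNIV" for \<eta>
    by (intro feasible_lower_bound[OF Xs_borel saddle that])
  then have "\<Psi> 0 (\<xi> k) \<le> \<Psi> 0 \<eta> + ereal e" if "\<eta> \<in> feas UNIV" for \<eta>
    using that by (cases "\<Psi> 0 \<eta>"; cases "\<Psi> 0 (\<xi> k)") force+
  then show thesis by (rule that)
qed

text \<open>\<open>\<xi>s\<close> lies below every iterate in value, so one nearly optimal iterate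
  per \<open>e\<close> is enough, wherever it occurs in the sequence.\<close>

lemma accumulation_optimal:
  assumes acc: "accumulation_point weak_topology \<xi> \<xi>s"
  shows "optimal_solution \<Psi> Iineq Ieq \<xi>s"
  unfolding optimal_solution_def
proof (intro conjI INF_greatest)
  show "\<xi>s \<in> feas UNIV" by (rule accumulation_feasible[OF acc])
  fix \<eta> assume \<eta>: "\<eta> \<in> feas UNIV"
  show "\<Psi> 0 \<xi>s \<le> \<Psi> 0 \<eta>"
  proof (rule ereal_le_epsilon2)
    fix e :: real assume "0 < e"
    then obtain k where "\<Psi> 0 (\<xi> k) \<le> \<Psi> 0 \<eta> + ereal e" using nearly_optimal \<eta> by blast
    then show "\<Psi> 0 \<xi>s \<le> \<Psi> 0 \<eta> + ereal e" using accumulation_feasible(2)[OF acc, of k] by (rule order_trans[rotated])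
  qed
qed

lemma values_converge:
  assumes acc: "accumulation_point weak_topology \<xi> \<xi>s"
  shows "(\<lambda>k. \<Psi> 0 (\<xi> k)) \<longlonglongrightarrow> \<Psi> 0 \<xi>s"
proof -
  have "(INF k. \<Psi> 0 (\<xi> k)) \<le> \<Psi> 0 \<xi>s"
  proof (rule ereal_le_epsilon2)
    fix e :: real assume "0 < e"
    then obtain k where "\<Psi> 0 (\<xi> k) \<le> \<Psi> 0 \<xi>s + ereal e"
      using nearly_optimal accumulation_feasible(1)[OF acc] by blast
    then show "(INF k. \<Psi> 0 (\<xi> k)) \<le> \<Psi> 0 \<xi>s + ereal e" by (rule INF_lower2[rotated]) simp
  qed
  then have "(INF k. \<Psi> 0 (\<xi> k)) = \<Psi> 0 \<xi>s"
    using accumulation_feasible(2)[OF acc] by (intro antisym INF_greatest)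
  then show ?thesis using LIMSEQ_INF[OF \<Psi>0_decreasing] by simp
qed

lemma accumulation_point_exists: "\<exists>\<xi>s. accumulation_point weak_topology \<xi> \<xi>s"
proof -
  obtain r \<xi>s where "strict_mono r" "limitin weak_topology (\<lambda>k. \<xi> (r k)) \<xi>s sequentially"
    by (rule weak_sequentially_compact[OF compact \<xi>_Xi])
  then have "accumulation_point weak_topology \<xi> \<xi>s" by (rule limitin_subseq_imp_accumulation_point)
  then show ?thesis by blast
qed

end

theorem theorem4p5:
  fixes \<Psi> :: "'i::zero \<Rightarrow> 'a::metric_space measure \<Rightarrow> ereal"
    and \<psi> :: "'i \<Rightarrow> 'a measure \<Rightarrow> 'a \<Rightarrow> real"
    and Iineq Ieq :: "'i set"
    and X0 :: "'a set"
    and \<delta> :: "nat \<Rightarrow> real"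
    and Xs :: "nat \<Rightarrow> 'a set"
    and \<xi> :: "nat \<Rightarrow> 'a measure"
    and l :: "nat \<Rightarrow> 'i \<Rightarrow> real"
    and x :: "nat \<Rightarrow> 'a"
  assumes compact: "compact (UNIV :: 'a set)"
    and index_sets: "finite Iineq" "finite Ieq" "Iineq \<inter> Ieq = {}" "0 \<notin> Iineq \<union> Ieq"
    and not_minf: "\<And>i \<eta>. i \<in> {0} \<union> Iineq \<Longrightarrow> \<eta> \<in> Xi UNIV \<Longrightarrow> \<Psi> i \<eta> \<noteq> -\<infinity>"
    and lsc: "\<And>i. i \<in> {0} \<union> Iineq \<Longrightarrow> lower_semicontinuous_map weak_topology (\<Psi> i)"
    and eq_real: "\<And>i \<eta>. i \<in> Ieq \<Longrightarrow> \<eta> \<in> Xi UNIV \<Longrightarrow> \<bar>\<Psi> i \<eta>\<bar> \<noteq> \<infinity>"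
    and eq_continuous: "\<And>i. i \<in> Ieq \<Longrightarrow> continuous_map weak_topology euclidean (\<Psi> i)"
    and objective: "convex_functional (\<Psi> 0)" "has_sensitivity (\<Psi> 0) (\<psi> 0)"
      "continuous_sensitivity (\<Psi> 0) (\<psi> 0)"
    and ineq_convex: "\<And>i. i \<in> Iineq \<Longrightarrow> convex_functional (\<Psi> i)"
    and ineq_sensitivity: "\<And>i. i \<in> Iineq \<Longrightarrow> has_sensitivity (\<Psi> i) (\<psi> i)"
    and ineq_sensitivity_form: "\<And>i. i \<in> Iineq \<Longrightarrow>
      continuous_sensitivity (\<Psi> i) (\<psi> i) \<or>
      (\<exists>g :: 'a \<Rightarrow> real. g \<in> borel_measurable borel \<and> bounded (range g) \<and>
         (\<forall>\<eta>\<in>fin_dom (\<Psi> i). \<forall>y. \<psi> i \<eta> y = g y - real_of_ereal (\<Psi> i \<eta>)))"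
    and eq_affine: "\<And>i. i \<in> Ieq \<Longrightarrow> affine_functional (\<Psi> i)"
    and eq_sensitivity: "\<And>i \<eta> y. i \<in> Ieq \<Longrightarrow> \<eta> \<in> Xi UNIV \<Longrightarrow>
      \<psi> i \<eta> y = real_of_ereal (\<Psi> i (return borel y)) - real_of_ereal (\<Psi> i \<eta>)"
    and tolerances: "\<And>k. 0 < \<delta> k" "limsup (\<lambda>k. ereal (\<delta> k)) = 0"
    and X0: "finite X0" "X0 \<noteq> {}"
    and slater: "\<exists>\<eta>0\<in>Xi_fin \<Psi> Iineq Ieq X0. (\<forall>i\<in>Iineq. \<Psi> i \<eta>0 < 0) \<and> (\<forall>i\<in>Ieq. \<Psi> i \<eta>0 = 0)"
    and not_one_sided: "\<not> one_sided Ieq ((\<lambda>\<eta>. \<lambda>i\<in>Ieq. real_of_ereal (\<Psi> i \<eta>)) ` Xi X0)"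
    and generated: "generated \<Psi> \<psi> Iineq Ieq X0 \<delta> Xs \<xi> l x"
  shows "(\<forall>K. terminates_at \<psi> Iineq Ieq \<delta> \<xi> l x K \<longrightarrow> optimal_solution \<Psi> Iineq Ieq (\<xi> K)) \<and>
    ((\<nexists>K. terminates_at \<psi> Iineq Ieq \<delta> \<xi> l x K) \<longrightarrow>
       (\<exists>\<xi>s. accumulation_point weak_topology \<xi> \<xi>s) \<and>
       (\<forall>\<xi>s. accumulation_point weak_topology \<xi> \<xi>s \<longrightarrow> optimal_solution \<Psi> Iineq Ieq \<xi>s) \<and>
       decseq (\<lambda>k. \<Psi> 0 (\<xi> k)) \<and>
       (\<exists>\<xi>s. optimal_solution \<Psi> Iineq Ieq \<xi>s \<and> (\<lambda>k. \<Psi> 0 (\<xi> k)) \<longlonglongrightarrow> \<Psi> 0 \<xi>s))"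
proof -
  \<comment> \<open>For equality constraints \<open>\<psi> i\<close> is given by its formula; that
    it is a sensitivity function has to be derived.\<close>
  have eq_sens: "has_sensitivity (\<Psi> i) (\<psi> i)"
    and eq_int: "\<And>\<xi> \<eta>. \<xi> \<in> Xi UNIV \<Longrightarrow> \<eta> \<in> Xi UNIV \<Longrightarrow>
      real_of_ereal (\<Psi> i \<xi>) + (\<integral>x. \<psi> i \<xi> x \<partial>\<eta>) = real_of_ereal (\<Psi> i \<eta>)" if "i \<in> Ieq" for i
    by (rule affine_sensitivity[OF compact eq_continuous[OF that] eq_real[OF that] eq_affine[OF that]
        eq_sensitivity[OF that]]; assumption)+
  interpret measure_program \<Psi> \<psi> Iineq Ieq
  proof
    show "\<Psi> i \<eta> \<noteq> -\<infinity>" if "i \<in> insert 0 (Iineq \<union> Ieq)" "\<eta> \<in> Xi UNIV" for i \<eta>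
      using that not_minf[of i \<eta>] eq_real[of i \<eta>] by auto
    show "convex_functional (\<Psi> i)" if "i \<in> insert 0 (Iineq \<union> Ieq)" for i
      using that objective(1) ineq_convex eq_affine affine_imp_convex by auto
    show "has_sensitivity (\<Psi> i) (\<psi> i)" if "i \<in> insert 0 (Iineq \<union> Ieq)" for i
      using that objective(2) ineq_sensitivity eq_sens by auto
  qed (use index_sets eq_real eq_affine eq_int in auto)

  have step: "saddle_point \<Psi> Iineq Ieq (Xs k) (\<xi> k) (l k)"
      "proceeds \<psi> Iineq Ieq \<delta> \<xi> l x k \<Longrightarrow> Xs (Suc k) = Xs k \<union> {x k}"
      "\<psi>L (\<xi> k) (l k) (x k) - \<delta> k \<le> \<psi>L (\<xi> k) (l k) y"
    if "\<forall>j<k. proceeds \<psi> Iineq Ieq \<delta> \<xi> l x j" for k y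
  proof -
    from generated that have gen: "saddle_point \<Psi> Iineq Ieq (Xs k) (\<xi> k) (l k)"
      "ereal (\<psi>L (\<xi> k) (l k) (x k)) \<le> (INF y. ereal (\<psi>L (\<xi> k) (l k) y)) + ereal (\<delta> k)"
      "proceeds \<psi> Iineq Ieq \<delta> \<xi> l x k \<longrightarrow> Xs (Suc k) = Xs k \<union> {x k}"
      unfolding generated_def by blast+
    show "saddle_point \<Psi> Iineq Ieq (Xs k) (\<xi> k) (l k)" by fact
    show "proceeds \<psi> Iineq Ieq \<delta> \<xi> l x k \<Longrightarrow> Xs (Suc k) = Xs k \<union> {x k}" using gen(3) by blast
    have "(INF y. ereal (\<psi>L (\<xi> k) (l k) y)) + ereal (\<delta> k) \<le> ereal (\<psi>L (\<xi> k) (l k) y) + ereal (\<delta> k)"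
      by (intro add_right_mono INF_lower) simp
    with gen(2) have "ereal (\<psi>L (\<xi> k) (l k) (x k)) \<le> ereal (\<psi>L (\<xi> k) (l k) y) + ereal (\<delta> k)"
      by (rule order_trans)
    then show "\<psi>L (\<xi> k) (l k) (x k) - \<delta> k \<le> \<psi>L (\<xi> k) (l k) y" by simp
  qed
  have Xs_0: "Xs 0 = X0" using generated by (simp add: generated_def)
  \<comment> \<open>At most one point is added per executed iteration; finiteness makes each
    discretization a Borel set.\<close>
  have "finite (Xs k)" if "\<forall>j<k. proceeds \<psi> Iineq Ieq \<delta> \<xi> l x j" for k
    using that by (induction k) (auto simp: Xs_0 X0 step(2))
  then have Xs_borel: "Xs k \<in> sets borel" if "\<forall>j<k. proceeds \<psi> Iineq Ieq \<delta> \<xi> l x j" for k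
    using that by (auto intro: borel_closed finite_imp_closed)

  have "optimal_solution \<Psi> Iineq Ieq (\<xi> K)" if K: "terminates_at \<psi> Iineq Ieq \<delta> \<xi> l x K" for K
  proof -
    have before: "\<forall>j<K. proceeds \<psi> Iineq Ieq \<delta> \<xi> l x j" and stop: "0 \<le> \<psi>L (\<xi> K) (l K) (x K) - \<delta> K"
      using K by (auto simp: terminates_at_def proceeds_def)
    have "0 \<le> \<psi>L (\<xi> K) (l K) y" for y using stop step(3)[OF before, of y] by linarith
    then have "\<Psi> 0 (\<xi> K) + ereal 0 \<le> \<Psi> 0 \<eta>" if "\<eta> \<in> feas UNIV" for \<eta>
      by (intro feasible_lower_bound[OF Xs_borel[OF before] step(1)[OF before] that])
    moreover have "\<xi> K \<in> feas UNIV"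
      using saddle_properties(3)[OF Xs_borel[OF before] step(1)[OF before]] Xi_iff_measure[OF Xs_borel[OF before]]
      by (auto simp: Xi_feas_def)
    ultimately show ?thesis by (auto simp: optimal_solution_def intro!: INF_greatest)
  qed
  moreover
  { assume "\<nexists>K. terminates_at \<psi> Iineq Ieq \<delta> \<xi> l x K"
    \<comment> \<open>By strong induction, since the first index that fails to proceed would be a
      terminating one.\<close>
    then have proceeds: "proceeds \<psi> Iineq Ieq \<delta> \<xi> l x k" for k
      by (induction k rule: less_induct) (auto simp: terminates_at_def)
    obtain \<eta>0 where \<eta>0: "\<eta>0 \<in> fin X0" "\<forall>i\<in>Iineq. \<Psi> i \<eta>0 < 0" "\<forall>i\<in>Ieq. \<Psi> i \<eta>0 = 0"
      using slater by blast
    have X0_borel: "X0 \<in> sets borel" using Xs_borel[of 0] Xs_0 by simp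
    have \<eta>0_fin: "\<eta>0 \<in> fin UNIV" using \<eta>0(1) fin_iff[OF X0_borel] by blast
    \<comment> \<open>Positivity supplies the lower half of convergence, the limsup the upper
      half.\<close>
    have "\<delta> \<longlonglongrightarrow> 0"
    proof (rule order_tendstoI)
      show "\<forall>\<^sub>F k in sequentially. a < \<delta> k" if "a < 0" for a
        using that tolerances(1) by (intro always_eventually allI) (rule less_trans)
      show "\<forall>\<^sub>F k in sequentially. \<delta> k < a" if "0 < a" for a
        using Limsup_lessD[of sequentially "\<lambda>k. ereal (\<delta> k)" "ereal a"] that tolerances(2) by simp
    qed
    have "continuous_sensitivity (\<Psi> i) (\<psi> i) \<or>
      (\<exists>g :: 'a \<Rightarrow> real. bounded (range g) \<and> (\<forall>\<eta>\<in>fin_dom (\<Psi> i). \<forall>y. \<psi> i \<eta> y = g y - P i \<eta>))"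
      if i: "i \<in> insert 0 I" for i
    proof (cases "i \<in> Ieq")
      case True
      \<comment> \<open>An affine continuous functional fits the second form, with \<open>g\<close>
        its values at Dirac measures; these are bounded by compactness.\<close>
      let ?g = "\<lambda>y. P i (return borel y)"
      have "continuous_on UNIV ?g" by (rule continuous_on_return[OF eq_continuous[OF True] eq_real[OF True]])
      then have "bounded (range ?g)" using compact by (intro compact_imp_bounded compact_continuous_image)
      then show ?thesis using eq_sensitivity[OF True] by (intro disjI2 exI[of _ ?g]) (auto simp: fin_dom_def)
    qed (use i objective(3) ineq_sensitivity_form in blast)
    then interpret infinite_run \<Psi> \<psi> Iineq Ieq Xs \<xi> l x \<delta> \<eta>0
    proof unfold_locales
      show "P i \<eta>0 < 0" if "i \<in> Iineq" for i
        using \<eta>0(2) that fin_real[OF \<eta>0_fin, of i] by (metis UnI1 ereal_less(2) insertI2 less_ereal.simps(1) zero_ereal_def)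
    qed (use compact lsc eq_continuous Xs_borel proceeds step Xs_0 \<eta>0 not_one_sided \<open>\<delta> \<longlonglongrightarrow> 0\<close> in auto)
    have "(\<exists>\<xi>s. accumulation_point weak_topology \<xi> \<xi>s) \<and>
       (\<forall>\<xi>s. accumulation_point weak_topology \<xi> \<xi>s \<longrightarrow> optimal_solution \<Psi> Iineq Ieq \<xi>s) \<and>
       decseq (\<lambda>k. \<Psi> 0 (\<xi> k)) \<and>
       (\<exists>\<xi>s. optimal_solution \<Psi> Iineq Ieq \<xi>s \<and> (\<lambda>k. \<Psi> 0 (\<xi> k)) \<longlonglongrightarrow> \<Psi> 0 \<xi>s)"
      using accumulation_point_exists accumulation_optimal \<Psi>0_decreasing values_converge by blast }
  ultimately show ?thesis by blast
qed

end
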